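(* Let $H$ be a $\mathrm{TS}(n,\lambda)$. Then $H$ is eulerian if and only if $H$ is not a $\mathrm{TS}(3,1)$.
   Context: A hypergraph $H=(V,E)$ has a non-empty finite vertex set $V$ and a finite collection $E$ of edges, each associated with a subset of $V$; parallel edges (distinct edges with the same vertex set) are allowed, so $E$ is a multiset of subsets of $V$ and edges are counted with multiplicity. The order of $H$ is $|V|$; $H$ is $3$-uniform if every edge has exactly $3$ vertices; $H$ is non-empty if it has at least one edge. A triple system of order $n$ and index $\lambda$, denoted $\mathrm{TS}(n,\lambda)$, is a non-empty $3$-uniform hypergraph of order $n$ in which every pair of distinct vertices lie together in exactly $\lambda$ edges. A walk is a sequence $v_0e_1v_1\dots v_{k-1}e_kv_k$ ($k\ge 0$) of vertices $v_i$ and edges $e_i$ such that $v_{i-1}\neq v_i$ and $v_{i-1},v_i\in e_i$ for all $i=1,\dots,k$; it is closed if $v_0=v_k$. It is a strict trail if $e_1,\dots,e_k$ are pairwise distinct edges. An Euler tour of $H$ is a closed strict trail traversing every edge of $H$ exactly once. $H$ is eulerian if it admits an Euler tour. *)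

theory Defs
  imports Main
begin

(* Edges are labels of an arbitrary type, so distinct edges may have the same
   vertex set. *)
record ('v, 'e) pre_hypergraph =
  verts :: "'v set"
  edges :: "'e set"
  ends :: "'e \<Rightarrow> 'v set"

locale hypergraph =
  fixes H :: "('v, 'e) pre_hypergraph"
  assumes finite_verts: "finite (verts H)"
    and verts_nonempty: "verts H \<noteq> {}"
    and finite_edges: "finite (edges H)"
    and ends_subset: "e \<in> edges H \<Longrightarrow> ends H e \<subseteq> verts H"

definition order :: "('v, 'e) pre_hypergraph \<Rightarrow> nat" where
  "order H = card (verts H)"

definition uniform :: "nat \<Rightarrow> ('v, 'e) pre_hypergraph \<Rightarrow> bool" where
  "uniform r H \<longleftrightarrow> (\<forall>e \<in> edges H. card (ends H e) = r)"

definition triple_system :: "nat \<Rightarrow> nat \<Rightarrow> ('v, 'e) pre_hypergraph \<Rightarrow> bool" where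
  "triple_system n l H \<longleftrightarrow>
     hypergraph H \<and> edges H \<noteq> {} \<and> uniform 3 H \<and> order H = n \<and>
     (\<forall>u \<in> verts H. \<forall>v \<in> verts H. u \<noteq> v \<longrightarrow>
        card {e \<in> edges H. u \<in> ends H e \<and> v \<in> ends H e} = l)"

(* The walk v_0 e_1 v_1 ... e_k v_k is given by vs = [v_0, ..., v_k] and
   es = [e_1, ..., e_k]; thus e_(i+1) is es ! i. *)
definition walk :: "('v, 'e) pre_hypergraph \<Rightarrow> 'v list \<Rightarrow> 'e list \<Rightarrow> bool" where
  "walk H vs es \<longleftrightarrow>
     length vs = Suc (length es) \<and> set vs \<subseteq> verts H \<and> set es \<subseteq> edges H \<and>
     (\<forall>i < length es. vs ! i \<noteq> vs ! Suc i \<and>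
        vs ! i \<in> ends H (es ! i) \<and> vs ! Suc i \<in> ends H (es ! i))"

definition closed_walk :: "('v, 'e) pre_hypergraph \<Rightarrow> 'v list \<Rightarrow> 'e list \<Rightarrow> bool" where
  "closed_walk H vs es \<longleftrightarrow> walk H vs es \<and> hd vs = last vs"

definition strict_trail :: "('v, 'e) pre_hypergraph \<Rightarrow> 'v list \<Rightarrow> 'e list \<Rightarrow> bool" where
  "strict_trail H vs es \<longleftrightarrow> walk H vs es \<and> distinct es"

definition euler_tour :: "('v, 'e) pre_hypergraph \<Rightarrow> 'v list \<Rightarrow> 'e list \<Rightarrow> bool" where
  "euler_tour H vs es \<longleftrightarrow>
     closed_walk H vs es \<and> strict_trail H vs es \<and> set es = edges H"

definition eulerian :: "('v, 'e) pre_hypergraph \<Rightarrow> bool" where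
  "eulerian H \<longleftrightarrow> (\<exists>vs es. euler_tour H vs es)"

end

theory Submission imports Defs begin

text \<open>
  When an Euler tour traverses a block it enters through one vertex, leaves through another and
  misses the third.  Conversely, let a function \<open>m\<close> select in every block \<open>e\<close> a vertex \<open>m e\<close>
  to be missed.  The remaining pairs of vertices are the edges of a multigraph, and an Euler
  circuit of this multigraph is an Euler tour of the triple system.  So the task is to find \<open>m\<close>
  such that all degrees are even and all chosen pairs lie in one connected component.

  The only operation on \<open>m\<close> is a flip: if \<open>a\<close> and \<open>b\<close> lie in \<open>e\<close> and one of them is the missed
  vertex of \<open>e\<close>, let \<open>e\<close> miss the other one instead.  This changes the parity of the degrees of
  \<open>a\<close> and \<open>b\<close> and of no other vertex.

  Even degrees (\<open>least_odd_empty\<close>).  Take \<open>m\<close> with as few odd vertices as possible.  If \<open>u\<close> and \<open>v\<close>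
  are odd, no block through both can be flippable at \<open>u\<close> and \<open>v\<close>, and no further vertex \<open>c\<close> can be
  linked to both by flips in two different blocks.  The oddness can be moved from \<open>u\<close> or \<open>v\<close> to the
  third vertex \<open>w\<close> of a block through \<open>u\<close> and \<open>v\<close>, so the same holds for all three pairs from
  \<open>{u, v, w}\<close>.  Hence flips link each vertex \<open>c\<close> to \<open>u\<close>, \<open>v\<close> and \<open>w\<close> in few blocks altogether;
  but almost every block through \<open>u\<close>, \<open>v\<close> or \<open>w\<close> provides such a link.  Counting both ways
  leaves only three vertices and index one.

  Connectivity.  Among the choices with even degrees take one with a largest possible component \<open>B\<close>.
  Two flips at \<open>a\<close> and \<open>d\<close> in two common blocks preserve all parities, and so do three flips along a
  triangle whose sides lie in three different blocks.  If \<open>a\<close> is in \<open>B\<close> and \<open>d\<close> is not, no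
  chosen pair is \<open>{a, d}\<close>, so every block through both is flippable at \<open>a\<close> and \<open>d\<close>; moreover \<open>a\<close>
  can be taken to be a vertex whose removal does not disconnect \<open>B\<close>.  For index at least two, the
  double flip then makes \<open>B\<close> larger unless all chosen pairs are inside \<open>B\<close>
  (\<open>double_index_all_in\<close>).  For index one, the triangles with one vertex in \<open>B\<close> show that the
  vertices outside \<open>B\<close> are pairwise joined by chosen pairs (\<open>outside_adjacent\<close>).  If there are
  chosen pairs outside \<open>B\<close> at all, there are then three vertices outside, and triangles with one
  vertex outside \<open>B\<close> force so much structure on the third vertices of their blocks that
  a contradiction results (\<open>no_triangle_outside\<close>).

  In a triple system with three vertices and index one there is just one block, and a tour of length
  one cannot be closed.
\<close>

section \<open>Closed trails in even connected multigraphs\<close>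

inductive trail :: "('e \<Rightarrow> 'v set) \<Rightarrow> 'v \<Rightarrow> 'e list \<Rightarrow> 'v \<Rightarrow> bool" for p where
  trail_Nil: "trail p u [] u"
| trail_Cons: "p e = {u, v} \<Longrightarrow> u \<noteq> v \<Longrightarrow> trail p v es w \<Longrightarrow> trail p u (e # es) w"

lemma trail_Nil_iff [simp]: "trail p u [] w \<longleftrightarrow> u = w"
  by (auto intro: trail_Nil elim: trail.cases)

lemma trail_Cons_iff:
  "trail p u (e # es) w \<longleftrightarrow> (\<exists>v. p e = {u, v} \<and> u \<noteq> v \<and> trail p v es w)"
  by (subst trail.simps) auto

lemma trail_append_iff:
  "trail p u (xs @ ys) w \<longleftrightarrow> (\<exists>v. trail p u xs v \<and> trail p v ys w)"
  by (induction xs arbitrary: u) (auto simp: trail_Cons_iff)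

text \<open>Every visit to an inner vertex uses two edges, one to arrive and one to leave.\<close>

lemma trail_parity:
  assumes "trail p u es w" "distinct es"
  shows "even (card {e \<in> set es. x \<in> p e}) \<longleftrightarrow> (x = u \<longleftrightarrow> x = w)"
  using assms
proof (induction rule: trail.induct)
  case (trail_Nil u)
  then show ?case by simp
next
  case (trail_Cons e u v es w)
  let ?S = "{e' \<in> set es. x \<in> p e'}"
  have *: "{e' \<in> set (e # es). x \<in> p e'} = (if x \<in> p e then insert e ?S else ?S)"
    by auto
  have "e \<notin> ?S" "finite ?S"
    using trail_Cons.prems by auto
  then have "card {e' \<in> set (e # es). x \<in> p e'} = (if x \<in> p e then Suc (card ?S) else card ?S)"
    unfolding * using card_insert_disjoint[of ?S e] by presburger
  then show ?case
    using trail_Cons by auto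
qed

lemma trail_rotate:
  assumes "trail p u es u" "e \<in> set es" "y \<in> p e"
  obtains es' where "trail p y es' y" "set es' = set es" "length es' = length es"
    "distinct es \<Longrightarrow> distinct es'"
proof -
  obtain xs ys where es: "es = xs @ e # ys"
    using assms(2) by (meson split_list)
  obtain v v' where v: "trail p u xs v" "p e = {v, v'}" "v \<noteq> v'" "trail p v' ys u"
    using assms(1) unfolding es trail_append_iff trail_Cons_iff by blast
  show thesis
  proof (cases "y = v")
    case True
    have "trail p y (e # ys @ xs) y"
      using v True by (auto simp: trail_Cons_iff trail_append_iff)
    then show ?thesis using that[of "e # ys @ xs"] es by auto
  next
    case False
    then have "trail p y (ys @ xs @ [e]) y"
      using v assms(3) by (auto simp: trail_Cons_iff trail_append_iff insert_commute)
    then show ?thesis using that[of "ys @ xs @ [e]"] es by auto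
  qed
qed

text \<open>
  A longest trail is closed, because at an end different from the start it has used an odd number of
  the evenly many edges there.  If it misses an edge, it misses one that meets it, and after rotation
  to the common vertex this edge extends it.
\<close>

lemma euler_circuit:
  fixes p :: "'e \<Rightarrow> 'v set"
  assumes fin: "finite E"
    and two: "\<And>e. e \<in> E \<Longrightarrow> card (p e) = 2"
    and even_deg: "\<And>x. even (card {e \<in> E. x \<in> p e})"
    and linked: "\<And>F. F \<subseteq> E \<Longrightarrow> F \<noteq> {} \<Longrightarrow> F \<noteq> E \<Longrightarrow> \<exists>e\<in>F. \<exists>e'\<in>E - F. p e \<inter> p e' \<noteq> {}"
    and ne: "E \<noteq> {}"
  obtains u es where "trail p u es u" "distinct es" "set es = E"
proof -
  have edge: "\<exists>b. p e = {a, b} \<and> a \<noteq> b" if "e \<in> E" "a \<in> p e" for e a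
    using two[OF that(1)] that(2) by (auto simp: card_2_iff)
  define P where "P = (\<lambda>(u, es, w). trail p u es w \<and> distinct es \<and> set es \<subseteq> E)"
  have "P (undefined, [], undefined)"
    by (simp add: P_def)
  moreover have "\<forall>t. P t \<longrightarrow> length (fst (snd t)) < Suc (card E)"
    using fin by (auto simp: P_def less_Suc_eq_le) (metis card_mono distinct_card)
  ultimately obtain t where t: "P t" "\<And>t'. P t' \<Longrightarrow> length (fst (snd t')) \<le> length (fst (snd t))"
    using ex_has_greatest_nat[of P _ "\<lambda>t. length (fst (snd t))"] by blast
  obtain u es w where t_eq: "t = (u, es, w)"
    by (metis prod_cases3)
  have tr: "trail p u es w" "distinct es" "set es \<subseteq> E"
    using t(1) by (auto simp: P_def t_eq)
  have longest: "length es' \<le> length es"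
    if "trail p u' es' w'" "distinct es'" "set es' \<subseteq> E" for u' es' w'
    using t(2)[of "(u', es', w')"] that by (simp add: P_def t_eq)
  have "u = w"
  proof (rule ccontr)
    assume "u \<noteq> w"
    then have "odd (card {e \<in> set es. w \<in> p e})"
      using trail_parity[OF tr(1,2), of w] by auto
    then have "{e \<in> set es. w \<in> p e} \<noteq> {e \<in> E. w \<in> p e}"
      using even_deg[of w] by auto
    then obtain e where e: "e \<in> E" "w \<in> p e" "e \<notin> set es"
      using tr(3) by blast
    obtain b where "p e = {w, b}" "w \<noteq> b"
      using edge e by blast
    then have "trail p u (es @ [e]) b"
      using tr by (auto simp: trail_append_iff trail_Cons_iff)
    then show False
      using longest[of u "es @ [e]" b] e tr by auto
  qed
  have "set es = E"
  proof (rule ccontr)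
    assume neq: "set es \<noteq> E"
    show False
    proof (cases "es = []")
      case True
      obtain e where e: "e \<in> E" using ne by blast
      then have "p e \<noteq> {}"
        using two by fastforce
      then obtain a where "a \<in> p e"
        by blast
      then obtain b where "p e = {a, b}" "a \<noteq> b"
        using edge e by blast
      then have "trail p a [e] b"
        by (auto simp: trail_Cons_iff)
      then show False
        using longest[of a "[e]" b] e True by auto
    next
      case False
      then obtain e e' y where e: "e \<in> set es" "e' \<in> E - set es" "y \<in> p e" "y \<in> p e'"
        using linked[of "set es"] neq tr(3) by auto
      obtain es' where es': "trail p y es' y" "set es' = set es" "length es' = length es" "distinct es'"
        using trail_rotate[of p u es e y] tr \<open>u = w\<close> e by metis
      obtain b where "p e' = {y, b}" "y \<noteq> b"
        using edge e by blast
      then have "trail p b (e' # es') y"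
        using es' by (auto simp: trail_Cons_iff insert_commute)
      then show False
        using longest[of b "e' # es'" y] e es' tr by auto
    qed
  qed
  then show thesis
    using that tr \<open>u = w\<close> by blast
qed

lemma trail_imp_walk:
  assumes "trail p u es w"
    and "\<And>e. e \<in> set es \<Longrightarrow> e \<in> edges H \<and> p e \<subseteq> ends H e"
    and "u \<in> verts H" and "\<And>e. e \<in> set es \<Longrightarrow> ends H e \<subseteq> verts H"
  shows "\<exists>vs. walk H vs es \<and> hd vs = u \<and> last vs = w"
  using assms
proof (induction rule: trail.induct)
  case (trail_Nil u)
  then show ?case
    by (intro exI[of _ "[u]"]) (simp add: walk_def)
next
  case (trail_Cons e u v es w)
  have v: "v \<in> verts H"
    using trail_Cons by force
  then obtain vs where vs: "walk H vs es" "hd vs = v" "last vs = w"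
    using trail_Cons by auto
  then obtain ws where ws: "vs = v # ws"
    unfolding walk_def by (cases vs) auto
  have "walk H (u # vs) (e # es)"
    using vs trail_Cons.hyps trail_Cons.prems unfolding walk_def ws
    by (auto simp: nth_Cons split: nat.splits)
  then show ?case
    using vs ws by (intro exI[of _ "u # vs"]) auto
qed

section \<open>Choosing a missed vertex in every block\<close>

locale triples =
  fixes V :: "'v set" and E :: "'e set" and I :: "'e \<Rightarrow> 'v set" and l :: nat
  assumes finV: "finite V" and finE: "finite E" and E_ne: "E \<noteq> {}"
    and IV: "\<And>e. e \<in> E \<Longrightarrow> I e \<subseteq> V"
    and I3: "\<And>e. e \<in> E \<Longrightarrow> card (I e) = 3"
    and pairs: "\<And>u v. u \<in> V \<Longrightarrow> v \<in> V \<Longrightarrow> u \<noteq> v \<Longrightarrow> card {e \<in> E. u \<in> I e \<and> v \<in> I e} = l"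
begin

lemma third_vertex:
  assumes "e \<in> E" "a \<in> I e" "b \<in> I e" "a \<noteq> b"
  obtains w where "I e = {a, b, w}" "w \<noteq> a" "w \<noteq> b" "w \<in> V"
proof -
  obtain x y z where xyz: "I e = {x, y, z}" "x \<noteq> y" "y \<noteq> z" "x \<noteq> z"
    using I3[OF assms(1)] unfolding card_3_iff by blast
  have "z \<in> V" "x \<in> V" "y \<in> V" using IV[OF assms(1)] xyz by auto
  then show thesis
    using that[of x] that[of y] that[of z] assms xyz by (auto simp: insert_commute)
qed

lemma two_vertices:
  assumes "e \<in> E" "a \<in> I e"
  obtains b c where "I e = {a, b, c}" "a \<noteq> b" "b \<noteq> c" "a \<noteq> c"
proof -
  obtain x y z where xyz: "I e = {x, y, z}" "x \<noteq> y" "y \<noteq> z" "x \<noteq> z"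
    using I3[OF assms(1)] unfolding card_3_iff by blast
  then show thesis
    using that[of y z] that[of x z] that[of x y] assms by (auto simp: insert_commute)
qed

lemma index_pos: "l > 0"
proof -
  obtain e where e: "e \<in> E" using E_ne by blast
  obtain x y z where xyz: "I e = {x, y, z}" "x \<noteq> y" "y \<noteq> z" "x \<noteq> z"
    using I3[OF e] unfolding card_3_iff by blast
  have "e \<in> {e \<in> E. x \<in> I e \<and> y \<in> I e}"
    using e xyz by auto
  then have "card {e \<in> E. x \<in> I e \<and> y \<in> I e} > 0"
    using finE by (auto simp: card_gt_0_iff)
  then show ?thesis
    using pairs[of x y] IV[OF e] xyz by auto
qed

lemma order_ge_3: "card V \<ge> 3"
proof -
  obtain e where e: "e \<in> E" using E_ne by blast
  show ?thesis using card_mono[OF finV IV[OF e]] I3[OF e] by simp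
qed

lemma block_exists:
  assumes "u \<in> V" "v \<in> V" "u \<noteq> v"
  obtains e where "e \<in> E" "u \<in> I e" "v \<in> I e"
proof -
  have "{e \<in> E. u \<in> I e \<and> v \<in> I e} \<noteq> {}"
    using pairs[OF assms] index_pos by (metis card.empty less_irrefl)
  then show thesis using that by blast
qed

lemma vertex_degree:
  assumes "z \<in> V"
  shows "2 * card {e \<in> E. z \<in> I e} = l * (card V - 1)"
proof -
  have "(\<Sum>c\<in>V - {z}. card {e \<in> {e \<in> E. z \<in> I e}. c \<in> I e}) = 2 * card {e \<in> E. z \<in> I e}"
  proof (rule sum_multicount)
    show "\<forall>e\<in>{e \<in> E. z \<in> I e}. card {c \<in> V - {z}. c \<in> I e} = 2"
    proof
      fix e assume e: "e \<in> {e \<in> E. z \<in> I e}"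
      then have "{c \<in> V - {z}. c \<in> I e} = I e - {z}"
        using IV by blast
      then show "card {c \<in> V - {z}. c \<in> I e} = 2"
        using e I3 by simp
    qed
  qed (use finV finE in auto)
  moreover have "(\<Sum>c\<in>V - {z}. card {e \<in> {e \<in> E. z \<in> I e}. c \<in> I e}) = (\<Sum>c\<in>V - {z}. l)"
    by (rule sum.cong) (use pairs assms in \<open>auto simp: conj_assoc\<close>)
  ultimately show ?thesis
    using finV assms by (simp add: mult.commute)
qed

text \<open>
  A choice \<open>m\<close> stands for the multigraph whose edges are the pairs \<open>I e - {m e}\<close>; \<open>deg m\<close> is its
  degree function.
\<close>

definition choice :: "('e \<Rightarrow> 'v) \<Rightarrow> bool" where
  "choice m \<longleftrightarrow> (\<forall>e\<in>E. m e \<in> I e)"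

definition deg :: "('e \<Rightarrow> 'v) \<Rightarrow> 'v \<Rightarrow> nat" where
  "deg m x = card {e \<in> E. x \<in> I e \<and> m e \<noteq> x}"

definition Odd :: "('e \<Rightarrow> 'v) \<Rightarrow> 'v set" where
  "Odd m = {x \<in> V. odd (deg m x)}"

text \<open>
  A flip is only used when \<open>m e\<close> is \<open>a\<close> or \<open>b\<close>; then it exchanges these two as missed vertices.
\<close>

definition flip :: "('e \<Rightarrow> 'v) \<Rightarrow> 'e \<Rightarrow> 'v \<Rightarrow> 'v \<Rightarrow> 'e \<Rightarrow> 'v" where
  "flip m e a b = m(e := if m e = a then b else a)"

lemma flip_other [simp]: "e' \<noteq> e \<Longrightarrow> flip m e a b e' = m e'"
  by (simp add: flip_def)

lemma flip_same: "flip m e a b e = (if m e = a then b else a)"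
  by (simp add: flip_def)

lemma choice_flip: "choice m \<Longrightarrow> a \<in> I e \<Longrightarrow> b \<in> I e \<Longrightarrow> choice (flip m e a b)"
  by (auto simp: choice_def flip_def)

lemma deg_flip:
  assumes "e \<in> E" "a \<in> I e" "b \<in> I e" "a \<noteq> b" "m e \<in> {a, b}"
  shows "odd (deg (flip m e a b) x) \<longleftrightarrow> (odd (deg m x) \<noteq> (x = a \<or> x = b))"
proof -
  let ?R = "{e' \<in> E - {e}. x \<in> I e' \<and> m e' \<noteq> x}"
  have split: "deg m' x = card ?R + (if x \<in> I e \<and> m' e \<noteq> x then 1 else 0)"
    if "\<And>e'. e' \<noteq> e \<Longrightarrow> m' e' = m e'" for m'
  proof -
    have "{e' \<in> E. x \<in> I e' \<and> m' e' \<noteq> x} = (if x \<in> I e \<and> m' e \<noteq> x then insert e ?R else ?R)"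
    proof (intro set_eqI)
      fix y
      show "y \<in> {e' \<in> E. x \<in> I e' \<and> m' e' \<noteq> x} \<longleftrightarrow> y \<in> (if x \<in> I e \<and> m' e \<noteq> x then insert e ?R else ?R)"
        by (cases "y = e") (use assms(1) that[of y] in auto)
    qed
    then show ?thesis
      unfolding deg_def using finE by simp
  qed
  show ?thesis
    using split[of m] split[of "flip m e a b"] assms by (auto simp: flip_same)
qed

lemma Odd_flip:
  assumes "e \<in> E" "a \<in> I e" "b \<in> I e" "a \<noteq> b" "m e \<in> {a, b}"
  shows "Odd (flip m e a b) = (Odd m - {a, b}) \<union> ({a, b} - Odd m)"
  using deg_flip[of e a b m] IV[OF assms(1)] assms unfolding Odd_def by blast

lemma even_card_Odd:
  assumes "choice m"
  shows "even (card (Odd m))"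
proof -
  have "(\<Sum>x\<in>V. deg m x) = 2 * card E"
    unfolding deg_def
  proof (rule sum_multicount)
    have "card {x \<in> V. x \<in> I e \<and> m e \<noteq> x} = 2" if e: "e \<in> E" for e
    proof -
      have "{x \<in> V. x \<in> I e \<and> m e \<noteq> x} = I e - {m e}"
        using IV[OF e] by auto
      then show ?thesis
        using assms e I3 by (simp add: choice_def)
    qed
    then show "\<forall>e\<in>E. card {x \<in> V. x \<in> I e \<and> m e \<noteq> x} = 2"
      by blast
  qed (use finV finE in auto)
  then have "even (\<Sum>x\<in>V. deg m x)" by simp
  then show ?thesis
    using finV by (simp add: even_sum_iff Odd_def)
qed

section \<open>Existence of an even choice\<close>

definition least_odd :: "('e \<Rightarrow> 'v) \<Rightarrow> bool" where
  "least_odd m \<longleftrightarrow> choice m \<and> (\<forall>m'. choice m' \<longrightarrow> card (Odd m) \<le> card (Odd m'))"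

lemma fin_Odd [simp]: "finite (Odd m)"
  using finV by (simp add: Odd_def)

lemma least_odd_contra:
  assumes "least_odd m" "choice m'" "Odd m' \<subset> Odd m"
  shows False
  using assms psubset_card_mono[OF fin_Odd assms(3)] unfolding least_odd_def
  by (meson not_less)

text \<open>
  Otherwise flipping \<open>e\<close> at \<open>u\<close> and \<open>v\<close> would make both of them even.
\<close>

lemma least_odd_one_block:
  assumes "least_odd m" "u \<in> Odd m" "v \<in> Odd m" "u \<noteq> v" "e \<in> E" "u \<in> I e" "v \<in> I e"
  shows "m e \<notin> {u, v}"
proof
  assume "m e \<in> {u, v}"
  then have "Odd (flip m e u v) = Odd m - {u, v}"
    using Odd_flip[of e u v m] assms by auto
  then show False
    using least_odd_contra[OF assms(1), of "flip m e u v"] choice_flip[of m u e v] assms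
    unfolding least_odd_def by blast
qed

text \<open>
  Two flips in different blocks, at \<open>u, c\<close> and at \<open>v, c\<close>, would make \<open>u\<close> and \<open>v\<close> even and leave the
  parity of \<open>c\<close> as it was.
\<close>

lemma least_odd_two_blocks:
  assumes "least_odd m" "u \<in> Odd m" "v \<in> Odd m" "u \<noteq> v" "c \<noteq> u" "c \<noteq> v"
    and "e \<in> E" "u \<in> I e" "c \<in> I e" "m e \<in> {u, c}"
    and "e' \<in> E" "v \<in> I e'" "c \<in> I e'" "m e' \<in> {v, c}"
  shows "e = e'"
proof (rule ccontr)
  assume neq: "e \<noteq> e'"
  let ?m1 = "flip m e u c"
  let ?m2 = "flip ?m1 e' v c"
  have 1: "Odd ?m1 = (Odd m - {u, c}) \<union> ({u, c} - Odd m)"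
    by (rule Odd_flip) (use assms in auto)
  have "Odd ?m2 = (Odd ?m1 - {v, c}) \<union> ({v, c} - Odd ?m1)"
    by (rule Odd_flip) (use assms neq in auto)
  also have "\<dots> = Odd m - {u, v}"
    unfolding 1 using assms by auto
  finally have "Odd ?m2 = Odd m - {u, v}" .
  moreover have "choice ?m2"
    using assms by (simp add: choice_flip least_odd_def)
  ultimately show False
    using least_odd_contra[OF assms(1), of ?m2] assms by blast
qed

text \<open>
  The oddness of \<open>u\<close> moves to \<open>w\<close>.  The vertex \<open>w\<close> was even before, since otherwise the flip
  would have reduced the number of odd vertices.
\<close>

lemma least_odd_move:
  assumes "least_odd m" "u \<in> Odd m" "v \<in> Odd m" "u \<noteq> v"
    and "e \<in> E" "I e = {u, v, w}" "w \<noteq> u" "w \<noteq> v" "m e = w"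
  shows "least_odd (flip m e u w)" "v \<in> Odd (flip m e u w)" "w \<in> Odd (flip m e u w)"
proof -
  let ?m = "flip m e u w"
  have odd: "Odd ?m = (Odd m - {u, w}) \<union> ({u, w} - Odd m)"
    by (rule Odd_flip) (use assms in auto)
  have ch: "choice ?m"
    using assms by (simp add: choice_flip least_odd_def)
  have "w \<notin> Odd m"
    using odd least_odd_contra[OF assms(1) ch] assms by blast
  then have odd': "Odd ?m = insert w (Odd m - {u})"
    using odd assms by auto
  then show "v \<in> Odd ?m" "w \<in> Odd ?m"
    using assms by auto
  have "card (Odd ?m) = card (Odd m)"
    unfolding odd' using assms \<open>w \<notin> Odd m\<close> card_Suc_Diff1[OF fin_Odd assms(2)] by simp
  then show "least_odd ?m"
    using assms(1) ch unfolding least_odd_def by auto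
qed

text \<open>
  Suppose \<open>u\<close> and \<open>v\<close> are odd, and let \<open>e0\<close> be a block \<open>{u, v, w}\<close>.  Flips in \<open>e0\<close> turn any two
  vertices of \<open>T = {u, v, w}\<close> into odd vertices of a minimal choice that agrees with \<open>m\<close> outside \<open>e0\<close>.
  For \<open>z\<close> in \<open>T\<close> and \<open>c\<close> outside \<open>T\<close>, let \<open>P z c\<close> be the set of blocks that are flippable at \<open>z\<close>
  and \<open>c\<close>.  By minimality, blocks in \<open>P z c\<close> and \<open>P z' c\<close> with different \<open>z, z'\<close> coincide, which
  bounds \<open>card (P u c) + card (P v c) + card (P w c)\<close> by \<open>l\<close>.  On the other hand every block other than
  \<open>e0\<close> through a vertex \<open>z\<close> of \<open>T\<close> is in some \<open>P z c\<close>.  With \<open>n\<close> vertices, each of which lies in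
  \<open>l * (n - 1) / 2\<close> blocks, summation gives \<open>3 * (l * (n - 1) / 2 - 1) \<le> l * (n - 3)\<close>, that is
  \<open>l * (n + 3) \<le> 6\<close>.
\<close>

lemma least_odd_empty:
  assumes "least_odd m" and big: "l \<ge> 2 \<or> card V \<ge> 4"
  shows "Odd m = {}"
proof (rule ccontr)
  assume ne: "Odd m \<noteq> {}"
  have "card (Odd m) \<noteq> 1"
    using even_card_Odd assms(1) unfolding least_odd_def by fastforce
  then obtain u v where uv: "u \<in> Odd m" "v \<in> Odd m" "u \<noteq> v"
    using ne by (metis card_1_singleton_iff One_nat_def is_singletonI' is_singleton_def)
  then have inV: "u \<in> V" "v \<in> V"
    by (auto simp: Odd_def)
  obtain e0 where e0: "e0 \<in> E" "u \<in> I e0" "v \<in> I e0"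
    using block_exists inV uv by metis
  obtain w where w: "I e0 = {u, v, w}" "w \<noteq> u" "w \<noteq> v" "w \<in> V"
    using third_vertex e0 uv by metis
  have me0: "m e0 = w"
    using least_odd_one_block[OF assms(1) uv e0] assms(1) w e0
    unfolding least_odd_def choice_def by auto
  define T where "T = {u, v, w}"
  have movable: "\<exists>m'. least_odd m' \<and> z \<in> Odd m' \<and> z' \<in> Odd m' \<and> (\<forall>e. e \<noteq> e0 \<longrightarrow> m' e = m e)"
    if z: "z \<in> T" "z' \<in> T" "z \<noteq> z'" for z z'
  proof -
    have A: "least_odd (flip m e0 u w)" "v \<in> Odd (flip m e0 u w)" "w \<in> Odd (flip m e0 u w)"
      using least_odd_move[of m u v e0 w] assms uv e0 w me0 by auto
    have B: "least_odd (flip m e0 v w)" "u \<in> Odd (flip m e0 v w)" "w \<in> Odd (flip m e0 v w)"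
      using least_odd_move[of m v u e0 w] assms uv e0 w me0 by (auto simp: insert_commute)
    from z consider "z = u \<and> z' = v \<or> z = v \<and> z' = u" | "z = w \<and> z' = v \<or> z = v \<and> z' = w"
      | "z = u \<and> z' = w \<or> z = w \<and> z' = u"
      unfolding T_def by auto
    then show ?thesis
    proof cases
      case 1 then show ?thesis using uv assms(1) by blast
    next
      case 2 then show ?thesis using A flip_other by metis
    next
      case 3 then show ?thesis using B flip_other by metis
    qed
  qed
  have one: "m e \<notin> {z, z'}"
    if "e \<in> E" "e \<noteq> e0" "z \<in> T" "z' \<in> T" "z \<noteq> z'" "z \<in> I e" "z' \<in> I e" for e z z'
    using movable[OF that(3-5)] least_odd_one_block that by metis
  define P where "P z c = {e \<in> E. z \<in> I e \<and> c \<in> I e \<and> m e \<in> {z, c}}" for z c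
  have finP: "finite (P z c)" for z c
    using finE by (simp add: P_def)
  have same: "e = e'"
    if c: "c \<in> V - T" and z: "z \<in> T" "z' \<in> T" "z \<noteq> z'" and e: "e \<in> P z c" "e' \<in> P z' c" for c z z' e e'
  proof -
    have "e \<noteq> e0" "e' \<noteq> e0"
      using c e w unfolding P_def T_def by auto
    moreover obtain m' where m': "least_odd m'" "z \<in> Odd m'" "z' \<in> Odd m'" "\<forall>e. e \<noteq> e0 \<longrightarrow> m' e = m e"
      using movable z by blast
    ultimately have mm: "m' e \<in> {z, c}" "m' e' \<in> {z', c}"
      using e by (auto simp: P_def)
    have cc: "c \<noteq> z" "c \<noteq> z'"
      using c z by auto
    have ee: "e \<in> E" "z \<in> I e" "c \<in> I e" "e' \<in> E" "z' \<in> I e'" "c \<in> I e'"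
      using e by (auto simp: P_def)
    show ?thesis
      by (rule least_odd_two_blocks[OF m'(1-3) z(3) cc ee(1-3) mm(1) ee(4-6) mm(2)])
  qed
  have Ple: "card (P z c) \<le> l" if "z \<in> T" "c \<in> V - T" for z c
  proof -
    have "card (P z c) \<le> card {e \<in> E. z \<in> I e \<and> c \<in> I e}"
      using finE by (intro card_mono) (auto simp: P_def)
    then show ?thesis
      using pairs[of z c] that inV w by (auto simp: T_def)
  qed
  have upper: "card (P u c) + card (P v c) + card (P w c) \<le> l" if c: "c \<in> V - T" for c
  proof -
    have T: "u \<in> T" "v \<in> T" "w \<in> T" by (auto simp: T_def)
    \<comment> \<open>If two of the three sets are non-empty, both consist of one block through two vertices of
      \<open>T\<close>.  The third set is then empty, and the index is at least two because \<open>e0\<close> is another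
      block through these two vertices.\<close>
    have *: "card (P z c) + card (P z' c) + card (P z'' c) \<le> l"
      if z: "z \<in> T" "z' \<in> T" "z'' \<in> T" "z \<noteq> z'" "z' \<noteq> z''" "z \<noteq> z''"
        and ne: "P z c \<noteq> {}" "P z' c \<noteq> {}" for z z' z''
    proof -
      obtain e where e: "e \<in> P z c" using ne by blast
      have Pe: "P z c = {e}" "P z' c = {e}"
        using same[OF c z(1,2,4)] e ne by blast+
      have "P z'' c = {}"
      proof (rule ccontr)
        assume "P z'' c \<noteq> {}"
        then have "e \<in> P z'' c"
          using same[OF c z(1,3,6) e] by blast
        then have "{z, z', z'', c} \<subseteq> I e"
          using Pe by (auto simp: P_def)
        moreover have "c \<noteq> z" "c \<noteq> z'" "c \<noteq> z''"
          using z c by auto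
        then have "card {z, z', z'', c} = 4"
          using z by simp
        moreover have "e \<in> E" using e by (simp add: P_def)
        ultimately show False
          using I3[of e] card_mono[of "I e" "{z, z', z'', c}"] card.infinite by force
      qed
      moreover have "2 \<le> l"
      proof -
        have "e \<in> E" "z \<in> I e" "z' \<in> I e" "c \<in> I e" using Pe by (auto simp: P_def)
        moreover have "c \<notin> I e0" "z \<in> I e0" "z' \<in> I e0" using c w z by (auto simp: T_def)
        ultimately have "e \<noteq> e0" "{e, e0} \<subseteq> {e \<in> E. z \<in> I e \<and> z' \<in> I e}"
          using e0 by auto
        moreover have "finite {e \<in> E. z \<in> I e \<and> z' \<in> I e}" using finE by simp
        ultimately have "card {e, e0} \<le> card {e \<in> E. z \<in> I e \<and> z' \<in> I e}" by (meson card_mono)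
        then show ?thesis
          using pairs[of z z'] z inV w \<open>e \<noteq> e0\<close> by (auto simp: T_def)
      qed
      ultimately show ?thesis using Pe by simp
    qed
    consider "P u c = {}" "P v c = {}" | "P u c = {}" "P w c = {}" | "P v c = {}" "P w c = {}"
      | "P u c \<noteq> {}" "P v c \<noteq> {}" | "P u c \<noteq> {}" "P w c \<noteq> {}" | "P v c \<noteq> {}" "P w c \<noteq> {}"
      by blast
    then show ?thesis
      using *[of u v w] *[of u w v] *[of v w u] T uv w Ple[OF _ c] by cases auto
  qed
  have lower: "card {e \<in> E. z \<in> I e} \<le> 1 + (\<Sum>c\<in>V - T. card (P z c))" if z: "z \<in> T" for z
  proof -
    have "{e \<in> E. z \<in> I e} \<subseteq> insert e0 (\<Union>c\<in>V - T. P z c)"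
    proof
      fix e assume e: "e \<in> {e \<in> E. z \<in> I e}"
      show "e \<in> insert e0 (\<Union>c\<in>V - T. P z c)"
      proof (cases "e = e0")
        case False
        have me: "m e \<in> I e" using e assms(1) by (auto simp: least_odd_def choice_def)
        show ?thesis
        \<comment> \<open>A block missing \<open>z\<close> can be flipped at \<open>z\<close> and any other vertex; a block missing another
          vertex \<open>m e\<close> can be flipped at \<open>z\<close> and \<open>m e\<close>.  By minimality the second vertex is not in \<open>T\<close>.\<close>
        proof (cases "m e = z")
          case True
          obtain b c where bc: "I e = {z, b, c}" "z \<noteq> b"
            using two_vertices[of e z] e by blast
          have "b \<notin> T"
            using one[of e z b] e False z bc True by auto
          then show ?thesis using e bc True IV[of e] by (auto simp: P_def)
        next
          case neq: False
          then have "m e \<notin> T"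
            using one[of e z "m e"] e me False z by auto
          then show ?thesis using e me IV[of e] by (auto simp: P_def)
        qed
      qed simp
    qed
    moreover have fin: "finite (\<Union>c\<in>V - T. P z c)"
      using finV finP by auto
    ultimately have "card {e \<in> E. z \<in> I e} \<le> card (insert e0 (\<Union>c\<in>V - T. P z c))"
      by (meson card_mono finite.insertI)
    also have "\<dots> \<le> 1 + card (\<Union>c\<in>V - T. P z c)"
      using fin by (simp add: card_insert_if)
    also have "\<dots> \<le> 1 + (\<Sum>c\<in>V - T. card (P z c))"
      using card_UN_le[of "V - T" "P z"] finV by simp
    finally show ?thesis .
  qed
  define r where "r = l * (card V - 1)"
  have T3: "card T = 3" "T \<subseteq> V" using uv w inV by (auto simp: T_def)
  have deg3: "r \<le> 2 + 2 * (\<Sum>c\<in>V - T. card (P z c))" if "z \<in> T" for z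
    using lower[OF that] vertex_degree[of z] that T3 unfolding r_def by fastforce
  have "(\<Sum>c\<in>V - T. card (P u c)) + (\<Sum>c\<in>V - T. card (P v c)) + (\<Sum>c\<in>V - T. card (P w c))
      = (\<Sum>c\<in>V - T. card (P u c) + card (P v c) + card (P w c))"
    by (simp add: sum.distrib)
  also have "\<dots> \<le> (\<Sum>c\<in>V - T. l)"
    by (rule sum_mono) (rule upper)
  also have "\<dots> = l * (card V - 3)"
    using T3 finV by (simp add: card_Diff_subset finite_subset)
  finally have "3 * r \<le> 6 + 2 * (l * (card V - 3))"
    using deg3[of u] deg3[of v] deg3[of w] by (simp add: T_def)
  moreover obtain k where k: "card V = k + 3"
    using order_ge_3 by (metis le_add_diff_inverse2)
  ultimately have "l * k + 6 * l \<le> 6"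
    unfolding r_def by (simp add: algebra_simps)
  then show False
    using big index_pos k by (cases "l = 1"; cases "k = 0") auto
qed

lemma even_choice_exists:
  assumes "l \<ge> 2 \<or> card V \<ge> 4"
  obtains m where "choice m" "Odd m = {}"
proof -
  have "choice (\<lambda>e. SOME x. x \<in> I e)"
    unfolding choice_def
  proof
    fix e assume "e \<in> E"
    then have "I e \<noteq> {}" using I3 by force
    then show "(SOME x. x \<in> I e) \<in> I e" by (simp add: some_in_eq)
  qed
  then obtain m where "least_odd m"
    unfolding least_odd_def
    using ex_has_least_nat[of choice _ "\<lambda>m. card (Odd m)"] by blast
  then show thesis
    using that least_odd_empty assms unfolding least_odd_def by blast
qed

section \<open>Connectivity of the chosen pairs\<close>


definition adj :: "('e \<Rightarrow> 'v) \<Rightarrow> ('v \<times> 'v) set" where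
  "adj m = {(a, b). a \<noteq> b \<and> (\<exists>e\<in>E. a \<in> I e \<and> b \<in> I e \<and> m e \<noteq> a \<and> m e \<noteq> b)}"

lemma adjI: "e \<in> E \<Longrightarrow> a \<in> I e \<Longrightarrow> b \<in> I e \<Longrightarrow> a \<noteq> b \<Longrightarrow> m e \<noteq> a \<Longrightarrow> m e \<noteq> b \<Longrightarrow> (a, b) \<in> adj m"
  unfolding adj_def by blast

lemma adjE:
  assumes "(a, b) \<in> adj m"
  obtains e where "e \<in> E" "a \<in> I e" "b \<in> I e" "a \<noteq> b" "m e \<noteq> a" "m e \<noteq> b"
  using assms unfolding adj_def by blast

lemma adj_sym: "(a, b) \<in> adj m \<Longrightarrow> (b, a) \<in> adj m"
  unfolding adj_def by blast

lemma adj_in_V: "(a, b) \<in> adj m \<Longrightarrow> a \<in> V \<and> b \<in> V"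
  unfolding adj_def using IV by blast

lemma pair_eq:
  assumes "e \<in> E" "a \<in> I e" "b \<in> I e" "a \<noteq> b" "m e \<in> I e" "m e \<noteq> a" "m e \<noteq> b"
  shows "I e - {m e} = {a, b}"
proof -
  obtain w where "I e = {a, b, w}" "w \<noteq> a" "w \<noteq> b"
    using third_vertex assms by metis
  then show ?thesis using assms by auto
qed

text \<open>
  \<open>reach m x\<close> is the component of \<open>x\<close>, while \<open>conn m C\<close> says that the multigraph induced on \<open>C\<close> is
  connected.  Both are used: components can be compared in size, whereas connectedness of an induced
  multigraph survives every change of \<open>m\<close> that does not touch a pair inside it.
\<close>

definition reach :: "('e \<Rightarrow> 'v) \<Rightarrow> 'v \<Rightarrow> 'v set" where
  "reach m x = {y. (x, y) \<in> (adj m)\<^sup>*}"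

definition conn :: "('e \<Rightarrow> 'v) \<Rightarrow> 'v set \<Rightarrow> bool" where
  "conn m C \<longleftrightarrow> (\<forall>y\<in>C. \<forall>z\<in>C. (y, z) \<in> (adj m \<inter> C \<times> C)\<^sup>*)"

lemma rtrancl_adj_sym: "(a, b) \<in> (adj m)\<^sup>* \<Longrightarrow> (b, a) \<in> (adj m)\<^sup>*"
  using sym_rtrancl[of "adj m"] adj_sym by (auto simp: sym_def)

lemma reach_subset_V: "x \<in> V \<Longrightarrow> reach m x \<subseteq> V"
proof
  fix y assume "x \<in> V" "y \<in> reach m x"
  then have "(x, y) \<in> (adj m)\<^sup>*" by (simp add: reach_def)
  then show "y \<in> V" using \<open>x \<in> V\<close> by (induction) (use adj_in_V in auto)
qed

lemma reach_closed: "y \<in> reach m x \<Longrightarrow> (y, z) \<in> adj m \<Longrightarrow> z \<in> reach m x"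
  unfolding reach_def by (simp add: rtrancl_into_rtrancl)

lemma reach_self [simp]: "x \<in> reach m x"
  by (simp add: reach_def)

lemma conn_reach: "conn m (reach m x)"
proof -
  let ?R = "adj m \<inter> reach m x \<times> reach m x"
  have *: "(x, y) \<in> ?R\<^sup>*" if "(x, y) \<in> (adj m)\<^sup>*" for y
    using that
  proof induction
    case (step y z)
    then have "(y, z) \<in> ?R"
      by (auto simp: reach_def intro: rtrancl_into_rtrancl)
    then show ?case using step by (meson rtrancl_into_rtrancl)
  qed simp
  have "sym ?R" using adj_sym by (auto intro!: symI)
  then have "sym (?R\<^sup>*)" by (rule sym_rtrancl)
  then show ?thesis
    unfolding conn_def using * by (metis (no_types, lifting) mem_Collect_eq reach_def rtrancl_trans symE)
qed

lemma conn_singleton: "conn m {x}"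
  by (simp add: conn_def)

lemma conn_insert:
  assumes "conn m C" "y \<in> C" "(y, z) \<in> adj m"
  shows "conn m (insert z C)"
proof -
  let ?R = "adj m \<inter> insert z C \<times> insert z C"
  have mono: "(adj m \<inter> C \<times> C)\<^sup>* \<subseteq> ?R\<^sup>*"
    by (rule rtrancl_mono) auto
  have yz: "(y, z) \<in> ?R" "(z, y) \<in> ?R" using assms adj_sym by auto
  have "(a, y) \<in> ?R\<^sup>* \<and> (y, a) \<in> ?R\<^sup>*" if "a \<in> insert z C" for a
    using that yz assms mono unfolding conn_def by (cases "a = z") blast+
  then show ?thesis
    unfolding conn_def by (meson rtrancl_trans)
qed

lemma conn_imp_reach: "conn m C \<Longrightarrow> x \<in> C \<Longrightarrow> C \<subseteq> reach m x"
  unfolding conn_def reach_def using rtrancl_mono[of "adj m \<inter> C \<times> C" "adj m"] by blast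

lemma conn_exit:
  assumes "conn m B" "C \<subseteq> B" "C \<noteq> {}" "C \<noteq> B"
  obtains y z where "y \<in> C" "z \<in> B - C" "(y, z) \<in> adj m"
proof (rule ccontr)
  assume no: "\<not> thesis"
  obtain c d where cd: "c \<in> C" "d \<in> B - C" using assms by blast
  then have "(c, d) \<in> (adj m \<inter> B \<times> B)\<^sup>*" using assms unfolding conn_def by blast
  then have "d \<in> C"
    by induction (use no that cd in auto)
  then show False using cd by blast
qed

text \<open>
  A largest connected proper subset of \<open>B\<close> can be enlarged by one vertex, and then it is \<open>B\<close>.
\<close>

lemma noncut_vertex:
  assumes "conn m B" "finite B" "2 \<le> card B"
  obtains a where "a \<in> B" "conn m (B - {a})"
proof -
  have "B \<noteq> {}" using assms by auto
  then obtain b where b: "b \<in> B" by blast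
  define Q where "Q C \<longleftrightarrow> conn m C \<and> C \<subset> B \<and> C \<noteq> {}" for C
  have "B \<noteq> {b}" using assms(3) by auto
  then have "Q {b}" using b by (auto simp: Q_def conn_singleton)
  moreover have "\<forall>C. Q C \<longrightarrow> card C < card B"
    using assms(2) psubset_card_mono by (auto simp: Q_def)
  ultimately obtain C where C: "Q C" "\<And>C'. Q C' \<Longrightarrow> card C' \<le> card C"
    using ex_has_greatest_nat[of Q "{b}" card] by blast
  obtain y z where yz: "y \<in> C" "z \<in> B - C" "(y, z) \<in> adj m"
    using conn_exit[OF assms(1), of C] C(1) unfolding Q_def by blast
  have "conn m (insert z C)"
    using conn_insert yz C(1) unfolding Q_def by blast
  have "finite C" using C(1) assms(2) unfolding Q_def by (meson finite_subset psubset_imp_subset)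
  then have "\<not> Q (insert z C)"
    using C(2)[of "insert z C"] yz by auto
  then have "insert z C = B"
    using \<open>conn m (insert z C)\<close> yz C(1) unfolding Q_def by blast
  then have "B - {z} = C" using yz by blast
  then show thesis using that[of z] yz C(1) unfolding Q_def by auto
qed

lemma conn_persists:
  assumes "conn m C" and "choice m"
    and "\<And>e. e \<in> E \<Longrightarrow> m' e \<noteq> m e \<Longrightarrow> \<not> I e - {m e} \<subseteq> C"
  shows "conn m' C"
proof -
  have "adj m \<inter> C \<times> C \<subseteq> adj m' \<inter> C \<times> C"
  proof clarify
    fix y z assume yz: "(y, z) \<in> adj m" "y \<in> C" "z \<in> C"
    then obtain e where e: "e \<in> E" "y \<in> I e" "z \<in> I e" "y \<noteq> z" "m e \<noteq> y" "m e \<noteq> z"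
      using adjE[OF yz(1)] by metis
    then have "I e - {m e} = {y, z}"
      using pair_eq assms(2) unfolding choice_def by metis
    then have "m' e = m e" using assms(3)[OF e(1)] yz by auto
    then have "(y, z) \<in> adj m'" using e by (intro adjI[of e]) auto
    then show "(y, z) \<in> adj m' \<inter> C \<times> C" using yz by blast
  qed
  then show ?thesis
    using assms(1) rtrancl_mono unfolding conn_def by blast
qed

text \<open>
  This covers changes of \<open>m\<close> that do remove pairs inside \<open>B\<close>, provided that detours, which may
  leave \<open>B\<close>, replace them.
\<close>

lemma reach_rerouted:
  assumes "conn m B" "t \<in> B"
    and "\<And>y z. y \<in> B \<Longrightarrow> z \<in> B \<Longrightarrow> (y, z) \<in> adj m \<Longrightarrow> (y, z) \<in> (adj m')\<^sup>*"
  shows "B \<subseteq> reach m' t"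
proof -
  have "(adj m \<inter> B \<times> B)\<^sup>* \<subseteq> (adj m')\<^sup>*"
    using rtrancl_mono[of "adj m \<inter> B \<times> B" "(adj m')\<^sup>*"] assms(3) by auto
  then show ?thesis using assms(1,2) unfolding conn_def reach_def by blast
qed

lemma two_edges_at:
  assumes "Odd m = {}" "(a, b) \<in> adj m"
  obtains e e' where "e \<in> E" "e' \<in> E" "e \<noteq> e'" "a \<in> I e" "a \<in> I e'" "m e \<noteq> a" "m e' \<noteq> a"
proof -
  let ?S = "{e \<in> E. a \<in> I e \<and> m e \<noteq> a}"
  have "even (card ?S)"
    using assms adj_in_V unfolding Odd_def deg_def by blast
  moreover have "finite ?S" "?S \<noteq> {}"
    using finE adjE[OF assms(2)] by auto
  ultimately obtain e where e: "e \<in> ?S" "?S \<noteq> {e}" by fastforce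
  then obtain e' where "e' \<in> ?S" "e' \<noteq> e" by blast
  then show thesis using that e by blast
qed

end

section \<open>A largest class\<close>

locale largest_class = triples V E I l
  for V :: "'v set" and E :: "'e set" and I :: "'e \<Rightarrow> 'v set" and l :: nat +
  fixes m :: "'e \<Rightarrow> 'v" and B :: "'v set" and x0 :: 'v
  assumes ch: "choice m" and ev: "Odd m = {}" and B_def: "B = reach m x0" and x0: "x0 \<in> V"
    and largest: "\<And>m' x. choice m' \<Longrightarrow> Odd m' = {} \<Longrightarrow> x \<in> V \<Longrightarrow> card (reach m' x) \<le> card B"
    and B2: "card B \<ge> 2"
begin

lemma BV: "B \<subseteq> V"
  using reach_subset_V x0 B_def by simp

lemma finB: "finite B"
  using BV finV finite_subset by blast

lemma conn_B: "conn m B"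
  using conn_reach B_def by simp

lemma B_closed: "y \<in> B \<Longrightarrow> (y, z) \<in> adj m \<Longrightarrow> z \<in> B"
  using reach_closed B_def by simp

lemma B_step: "(y, z) \<in> adj m \<Longrightarrow> y \<in> B \<longleftrightarrow> z \<in> B"
  using B_closed adj_sym by blast

lemma no_larger:
  assumes "choice m'" "Odd m' = {}" "x \<in> V" "C \<subseteq> reach m' x" "card B < card C"
  shows False
proof -
  have "finite (reach m' x)"
    using reach_subset_V[OF assms(3)] finV finite_subset by blast
  then have "card C \<le> card (reach m' x)"
    using assms(4) card_mono by blast
  then show False
    using largest[OF assms(1-3)] assms(5) by simp
qed

text \<open>
  The component of \<open>y\<close> would contain \<open>B\<close> and \<open>z\<close>, because all pairs inside \<open>B\<close> are kept.
\<close>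

lemma no_growth:
  assumes "choice m'" "Odd m' = {}"
    and "\<And>e. e \<in> E \<Longrightarrow> m' e \<noteq> m e \<Longrightarrow> \<not> I e - {m e} \<subseteq> B"
    and "(y, z) \<in> adj m'" "y \<in> B" "z \<notin> B"
  shows False
proof -
  have "conn m' (insert z B)"
    using conn_insert conn_persists[OF conn_B ch assms(3)] assms by blast
  then have "insert z B \<subseteq> reach m' y"
    using conn_imp_reach assms by blast
  then show False
    using no_larger[OF assms(1,2), of y "insert z B"] assms BV finB by auto
qed

text \<open>
  The change may also affect pairs at a vertex \<open>a\<close> of \<open>B\<close>, whose connection to \<open>B\<close> may be
  lost.  To exceed the size of \<open>B\<close> one then has to attach two vertices to \<open>B - {a}\<close>; one of them can
  be \<open>a\<close> itself.
\<close>

lemma no_growth_but_one: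
  assumes a: "a \<in> B" "conn m (B - {a})" and m': "choice m'" "Odd m' = {}"
    and *: "\<And>e. e \<in> E \<Longrightarrow> m' e \<noteq> m e \<Longrightarrow> \<not> I e - {m e} \<subseteq> B - {a}"
    and y: "(y, z) \<in> adj m'" "y \<in> B - {a}" "z \<notin> B - {a}"
    and y': "(y', z') \<in> adj m'" "y' \<in> insert z (B - {a})" "z' \<notin> insert z (B - {a})"
  shows False
proof -
  have "conn m' (insert z' (insert z (B - {a})))"
    using conn_insert conn_persists[OF a(2) ch *] y y' by blast
  then have "insert z' (insert z (B - {a})) \<subseteq> reach m' y"
    using conn_imp_reach y by blast
  moreover have "card (insert z' (insert z (B - {a}))) = Suc (card B)"
    using y' y finB a(1) by (simp add: card_Diff_singleton) (use B2 in linarith)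
  ultimately show False
    using no_larger[OF m', of y "insert z' (insert z (B - {a}))"] y BV by auto
qed

text \<open>
  The degree of \<open>a\<close> is even and positive, so if just one pair at \<open>a\<close> changes, another one is left.
\<close>

lemma still_attached:
  assumes a: "a \<in> B" and one: "\<And>k. k \<in> E \<Longrightarrow> m' k \<noteq> m k \<Longrightarrow> a \<in> I k \<Longrightarrow> m k \<noteq> a \<Longrightarrow> k = e"
  obtains y where "y \<in> B - {a}" "(y, a) \<in> adj m'"
proof -
  have "{a} \<noteq> B" using B2 by auto
  then obtain b where b: "(a, b) \<in> adj m"
    using conn_exit[OF conn_B, of "{a}"] a by blast
  obtain k where k: "k \<in> E" "k \<noteq> e" "a \<in> I k" "m k \<noteq> a"
    using two_edges_at[OF ev b] by metis
  then obtain c where c: "I k - {m k} = {a, c}" "c \<noteq> a"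
  proof -
    have "m k \<in> I k" using ch k by (simp add: choice_def)
    then obtain w where w: "I k = {a, m k, w}" "w \<noteq> a" "w \<noteq> m k"
      using third_vertex[of k a "m k"] k by metis
    then have "I k - {m k} = {a, w}" using k by auto
    then show thesis using that w by blast
  qed
  then have ac: "c \<in> I k" "m k \<noteq> c" by auto
  then have "(a, c) \<in> adj m" using k c by (intro adjI[of k]) auto
  then have "c \<in> B" using B_closed a by blast
  moreover have "m' k = m k" using one k by blast
  then have "(c, a) \<in> adj m'" using k c ac by (intro adjI[of k]) auto
  ultimately show thesis using that c by blast
qed

lemma missed_between:
  assumes "e \<in> E" "a \<in> I e" "d \<in> I e" "a \<in> B" "d \<notin> B"
  shows "m e \<in> {a, d}"
proof (rule ccontr)
  assume "m e \<notin> {a, d}"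
  then have "(a, d) \<in> adj m" using assms by (intro adjI[of e]) auto
  then show False using B_closed assms by blast
qed

text \<open>
  As \<open>a\<close> and \<open>d\<close> are in different components, the chosen pair of the block joins \<open>w\<close> to one of
  them, and thereby tells the component of \<open>w\<close>.
\<close>

lemma third_side:
  assumes "e \<in> E" "I e = {a, d, w}" "w \<noteq> a" "w \<noteq> d" "a \<in> B" "d \<notin> B"
  shows "w \<in> B \<longleftrightarrow> m e = d"
proof (cases "m e = d")
  case True
  then have "(a, w) \<in> adj m" using assms by (intro adjI[of e]) auto
  then show ?thesis using True assms(5) B_closed by blast
next
  case False
  then have "m e = a" using missed_between[of e a d] assms by auto
  then have "(d, w) \<in> adj m" using assms by (intro adjI[of e]) auto
  then show ?thesis using False assms(6) B_step by blast
qed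

text \<open>
  Let \<open>d\<close> be outside \<open>B\<close>, let \<open>a\<close> be in \<open>B\<close> with \<open>B - {a}\<close> connected, and flip two blocks
  \<open>{a, d, w}\<close> and \<open>{a, d, w'}\<close> at \<open>a\<close> and \<open>d\<close>.  This moves the ends of the chosen pairs at \<open>w\<close> and
  \<open>w'\<close> from \<open>a\<close> to \<open>d\<close> or from \<open>d\<close> to \<open>a\<close>.  If both ends were at \<open>d\<close>, then \<open>B\<close> is
  unaffected and \<open>w\<close> is attached to it.  If one was at \<open>a\<close>, then \<open>a\<close> retains another pair
  and \<open>d\<close> is attached to \<open>B\<close>.  If both were at \<open>a\<close>, then \<open>a\<close> may be lost, but \<open>d\<close> brings
  along its neighbour \<open>d'\<close>.
\<close>

lemma double_index_all_in:
  assumes l2: "l \<ge> 2" and d: "(d, d') \<in> adj m"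
  shows "d \<in> B"
proof (rule ccontr)
  assume dB: "d \<notin> B"
  then have d'B: "d' \<notin> B" using B_step d by blast
  obtain a where a: "a \<in> B" "conn m (B - {a})"
    using noncut_vertex[OF conn_B finB B2] by blast
  have ad: "a \<noteq> d" "a \<in> V" "d \<in> V" using a dB BV d adj_in_V by auto
  then have "card {e \<in> E. a \<in> I e \<and> d \<in> I e} \<ge> 2" using pairs l2 by simp
  then obtain e e' where e: "e \<in> E" "e' \<in> E" "e \<noteq> e'" "a \<in> I e" "d \<in> I e" "a \<in> I e'" "d \<in> I e'"
    by (auto simp: numeral_2_eq_2 card_le_Suc_iff)
  obtain w where w: "I e = {a, d, w}" "w \<noteq> a" "w \<noteq> d" using third_vertex e ad by metis
  obtain w' where w': "I e' = {a, d, w'}" "w' \<noteq> a" "w' \<noteq> d" using third_vertex e ad by metis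
  have me: "m e \<in> {a, d}" "m e' \<in> {a, d}" using missed_between e a dB by blast+
  define m' where "m' = flip (flip m e a d) e' a d"
  have m'e: "m' e = (if m e = a then d else a)" "m' e' = (if m e' = a then d else a)"
    using e by (auto simp: m'_def flip_same)
  have other: "m' k = m k" if "k \<noteq> e" "k \<noteq> e'" for k using that by (simp add: m'_def)
  have "choice m'" using ch e by (simp add: m'_def choice_flip)
  moreover have "Odd m' = {}"
    using Odd_flip[of e' a d "flip m e a d"] Odd_flip[of e a d m] e me ad ev by (auto simp: m'_def)
  ultimately have m': "choice m'" "Odd m' = {}" .
  have pe: "I e - {m e} = (if m e = a then {d, w} else {a, w})"
    using me w ad by auto
  have pe': "I e' - {m e'} = (if m e' = a then {d, w'} else {a, w'})"
    using me w' ad by auto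
  have wB: "w \<in> B \<longleftrightarrow> m e = d" and w'B: "w' \<in> B \<longleftrightarrow> m e' = d"
    using third_side[OF e(1) w] third_side[OF e(2) w'] a(1) dB by blast+
  have Je: "(if m e = a then a else d, w) \<in> adj m'"
    using e w ad me m'e by (intro adjI[of e]) auto
  have Je': "(if m e' = a then a else d, w') \<in> adj m'"
    using e w' ad me m'e by (intro adjI[of e']) auto
  have changed: "\<not> I k - {m k} \<subseteq> B - {a}" if "m' k \<noteq> m k" for k
  proof -
    have "k = e \<or> k = e'" using other that by blast
    then show ?thesis using pe pe' dB by (auto split: if_splits)
  qed
  show False
  proof (cases "m e = a \<and> m e' = a")
    case True
    have "\<not> I k - {m k} \<subseteq> B" if "m' k \<noteq> m k" for k
    proof -
      have "k = e \<or> k = e'" using other that by blast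
      then show ?thesis using pe pe' dB True by auto
    qed
    then show False using no_growth[OF m', of a w] Je True wB a ad by auto
  next
    case False
    show False
    proof (cases "m e = d \<and> m e' = d")
      case True
      obtain g where g: "g \<in> E" "d \<in> I g" "d' \<in> I g" "d \<noteq> d'" "m g \<noteq> d" "m g \<noteq> d'"
        using adjE[OF d] by metis
      then have "g \<noteq> e" "g \<noteq> e'" using True by auto
      then have "m' g = m g" using other by blast
      then have "(d, d') \<in> adj m'" using g by (intro adjI[of g]) auto
      moreover have "(w, d) \<in> adj m'" using Je True ad adj_sym by auto
      ultimately show False
        using no_growth_but_one[OF a m' changed, of w d d d'] True wB w dB d'B g by auto
    next
      case F2: False
      have mixed: "\<exists>w. (w, d) \<in> adj m' \<and> w \<in> B - {a}"
      proof (cases "m e = d")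
        case True then show ?thesis using Je adj_sym wB w ad by (intro exI[of _ w]) auto
      next
        case f: False
        then have "m e' = d" using F2 False me by auto
        then show ?thesis using Je' adj_sym w'B w' ad by (intro exI[of _ w']) auto
      qed
      then obtain v where v: "(v, d) \<in> adj m'" "v \<in> B - {a}" by blast
      have "\<exists>f. \<forall>k. k \<in> E \<and> m' k \<noteq> m k \<and> a \<in> I k \<and> m k \<noteq> a \<longrightarrow> k = f"
        using F2 False me other by (metis insertE singletonD)
      then obtain y where y: "y \<in> B - {a}" "(y, a) \<in> adj m'"
        using still_attached[OF a(1)] by metis
      show False
        using no_growth_but_one[OF a m' changed, of y a v d] y v dB ad by auto
    qed
  qed
qed

end

section \<open>Index one: trading along triangles\<close>

locale steiner_class = largest_class V E I l m B x0
  for V :: "'v set" and E :: "'e set" and I :: "'e \<Rightarrow> 'v set" and l :: nat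
    and m :: "'e \<Rightarrow> 'v" and B :: "'v set" and x0 :: 'v +
  assumes l1: "l = 1"
begin

text \<open>
  For index one, two vertices determine their common block and its third vertex.
\<close>

definition block :: "'v \<Rightarrow> 'v \<Rightarrow> 'e" where
  "block u v = (SOME e. e \<in> E \<and> u \<in> I e \<and> v \<in> I e)"

definition third :: "'v \<Rightarrow> 'v \<Rightarrow> 'v" where
  "third u v = (SOME w. I (block u v) = {u, v, w} \<and> w \<noteq> u \<and> w \<noteq> v)"

lemma block_in:
  assumes "u \<in> V" "v \<in> V" "u \<noteq> v"
  shows "block u v \<in> E" "u \<in> I (block u v)" "v \<in> I (block u v)"
proof -
  have "\<exists>e. e \<in> E \<and> u \<in> I e \<and> v \<in> I e" using block_exists[OF assms] by blast
  then show "block u v \<in> E" "u \<in> I (block u v)" "v \<in> I (block u v)"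
    unfolding block_def by (metis (mono_tags, lifting) someI_ex)+
qed

lemma block_eq:
  assumes "e \<in> E" "u \<in> I e" "v \<in> I e" "u \<noteq> v"
  shows "block u v = e"
proof -
  have V: "u \<in> V" "v \<in> V" using IV assms by blast+
  have "card {e \<in> E. u \<in> I e \<and> v \<in> I e} = 1" using pairs V assms l1 by simp
  then obtain f where "{e \<in> E. u \<in> I e \<and> v \<in> I e} = {f}" by (auto simp: card_1_singleton_iff)
  moreover have "block u v \<in> {e \<in> E. u \<in> I e \<and> v \<in> I e}" "e \<in> {e \<in> E. u \<in> I e \<and> v \<in> I e}"
    using block_in[OF V assms(4)] assms by auto
  ultimately show ?thesis by (metis singletonD)
qed

lemma third_in:
  assumes "u \<in> V" "v \<in> V" "u \<noteq> v"
  shows "I (block u v) = {u, v, third u v}" "third u v \<noteq> u" "third u v \<noteq> v" "third u v \<in> V"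
proof -
  have "\<exists>w. I (block u v) = {u, v, w} \<and> w \<noteq> u \<and> w \<noteq> v"
    using third_vertex[of "block u v" u v] block_in[OF assms] assms(3) by metis
  then have *: "I (block u v) = {u, v, third u v} \<and> third u v \<noteq> u \<and> third u v \<noteq> v"
    unfolding third_def by (rule someI_ex)
  then show "I (block u v) = {u, v, third u v}" "third u v \<noteq> u" "third u v \<noteq> v" by auto
  show "third u v \<in> V" using IV[OF block_in(1)[OF assms]] * by auto
qed

lemma third_eq:
  assumes "e \<in> E" "I e = {u, v, w}" "u \<noteq> v" "w \<noteq> u" "w \<noteq> v"
  shows "third u v = w" "block u v = e"
proof -
  show b: "block u v = e" using block_eq[of e u v] assms by auto
  have "u \<in> V" "v \<in> V" using IV[OF assms(1)] assms by auto
  then have "I e = {u, v, third u v}" "third u v \<noteq> u" "third u v \<noteq> v" using third_in[of u v] assms b by auto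
  then show "third u v = w" using assms by auto
qed

lemma third_commute: "u \<in> V \<Longrightarrow> v \<in> V \<Longrightarrow> u \<noteq> v \<Longrightarrow> third u v = third v u"
  using third_eq(1)[of "block u v" v u "third u v"] third_in[of u v] block_in[of u v] by (auto simp: insert_commute)

lemma third_third: "u \<in> V \<Longrightarrow> v \<in> V \<Longrightarrow> u \<noteq> v \<Longrightarrow> third u (third u v) = v \<and> block u (third u v) = block u v"
  using third_eq[of "block u v" u "third u v" v] third_in[of u v] block_in[of u v] by (auto simp: insert_commute)

text \<open>
  Three flips along a triangle; the parity of each corner changes twice.
\<close>

definition tri :: "'v \<Rightarrow> 'v \<Rightarrow> 'v \<Rightarrow> 'e \<Rightarrow> 'v" where
  "tri a b c = flip (flip (flip m (block a b) a b) (block a c) a c) (block b c) b c"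

lemma triangle:
  assumes V: "a \<in> V" "b \<in> V" "c \<in> V" and d: "a \<noteq> b" "a \<noteq> c" "b \<noteq> c"
    and c: "c \<notin> I (block a b)"
    and miss: "m (block a b) \<in> {a, b}" "m (block a c) \<in> {a, c}" "m (block b c) \<in> {b, c}"
  shows "choice (tri a b c)" "Odd (tri a b c) = {}"
    and "tri a b c (block a b) = (if m (block a b) = a then b else a)"
    and "tri a b c (block a c) = (if m (block a c) = a then c else a)"
    and "tri a b c (block b c) = (if m (block b c) = b then c else b)"
    and "\<And>k. k \<noteq> block a b \<Longrightarrow> k \<noteq> block a c \<Longrightarrow> k \<noteq> block b c \<Longrightarrow> tri a b c k = m k"
proof -
  note ab = block_in[OF V(1,2) d(1)] and ac = block_in[OF V(1,3) d(2)] and bc = block_in[OF V(2,3) d(3)]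
  have ne: "block a b \<noteq> block a c" "block a b \<noteq> block b c" using c ac bc by auto
  have ne': "block a c \<noteq> block b c"
  proof
    assume "block a c = block b c"
    then have "block a b = block a c" using block_eq[of "block a c" a b] ac bc d by auto
    then show False using ne by blast
  qed
  show "choice (tri a b c)"
    unfolding tri_def using ch ab ac bc by (intro choice_flip) auto
  let ?m1 = "flip m (block a b) a b"
  let ?m2 = "flip ?m1 (block a c) a c"
  have 1: "Odd ?m1 = {a, b}" using Odd_flip[of "block a b" a b m] ab d miss ev by auto
  have "Odd ?m2 = (Odd ?m1 - {a, c}) \<union> ({a, c} - Odd ?m1)"
    by (rule Odd_flip[OF ac d(2)]) (use ne miss in auto)
  then have 2: "Odd ?m2 = {b, c}" using 1 d by auto
  have "Odd (tri a b c) = (Odd ?m2 - {b, c}) \<union> ({b, c} - Odd ?m2)"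
    unfolding tri_def by (rule Odd_flip[OF bc d(3)]) (use ne ne' miss in auto)
  then show "Odd (tri a b c) = {}" using 2 by auto
  show "tri a b c (block a b) = (if m (block a b) = a then b else a)"
    "tri a b c (block a c) = (if m (block a c) = a then c else a)"
    "tri a b c (block b c) = (if m (block b c) = b then c else b)"
    "\<And>k. k \<noteq> block a b \<Longrightarrow> k \<noteq> block a c \<Longrightarrow> k \<noteq> block b c \<Longrightarrow> tri a b c k = m k"
    unfolding tri_def using ne ne' by (auto simp: flip_same)
qed

text \<open>
  Suppose the block through \<open>x\<close> and \<open>p\<close> is flippable at \<open>x\<close> and \<open>p\<close>.  Flip the triangle formed
  by these and a vertex \<open>a\<close> of \<open>B\<close> with \<open>B - {a}\<close> connected, and consider the chosen pairs of the two
  blocks at \<open>a\<close>.  If neither of them contains \<open>a\<close>, then \<open>B\<close> is unaffected and \<open>a\<close> gains a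
  neighbour outside \<open>B\<close>.  If one contains \<open>a\<close>, then \<open>a\<close> retains another pair and \<open>x\<close> or \<open>p\<close> is attached to
  \<open>B\<close>.  If both do, then \<open>a\<close> may be lost, but both \<open>x\<close> and \<open>p\<close> are attached.
\<close>

lemma outside_adjacent:
  assumes x: "x \<in> V - B" and p: "p \<in> V - B" and "x \<noteq> p"
  shows "m (block x p) \<notin> {x, p}"
proof
  assume g: "m (block x p) \<in> {x, p}"
  obtain a where a: "a \<in> B" "conn m (B - {a})"
    using noncut_vertex[OF conn_B finB B2] by blast
  have V: "a \<in> V" "x \<in> V" "p \<in> V" and d: "a \<noteq> x" "a \<noteq> p" "x \<noteq> p"
    using a BV x p assms by auto
  note ax = block_in[OF V(1,2) d(1)] third_in[OF V(1,2) d(1)]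
    and ap = block_in[OF V(1,3) d(2)] third_in[OF V(1,3) d(2)]
    and xp = block_in[OF V(2,3) d(3)]
  have me: "m (block a x) \<in> {a, x}" "m (block a p) \<in> {a, p}"
    using missed_between ax ap a x p by blast+
  have sx: "third a x \<in> B \<longleftrightarrow> m (block a x) = x"
    using third_side[of "block a x" a x "third a x"] ax a x by auto
  have sp: "third a p \<in> B \<longleftrightarrow> m (block a p) = p"
    using third_side[of "block a p" a p "third a p"] ap a p by auto
  have "p \<notin> I (block a x)"
  proof
    assume "p \<in> I (block a x)"
    then have "block a p = block a x" "block x p = block a x"
      using block_eq[of "block a x" a p] block_eq[of "block a x" x p] ax(1-3) d by blast+
    then show False using me g d by auto
  qed
  note t = triangle[OF V d this me g]
  let ?m = "tri a x p"
  have Jx: "(if m (block a x) = a then a else x, third a x) \<in> adj ?m"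
    using ax me t(3) d by (intro adjI[of "block a x"]) auto
  have Jp: "(if m (block a p) = a then a else p, third a p) \<in> adj ?m"
    using ap me t(4) d by (intro adjI[of "block a p"]) auto
  have ga: "a \<notin> I (block x p)"
  proof
    assume "a \<in> I (block x p)"
    then have "block a p = block x p" "block a x = block x p"
      using block_eq[of "block x p" a p] block_eq[of "block x p" a x] xp d by blast+
    then show False using me g d by auto
  qed
  have changed_cases: "k = block a x \<or> k = block a p \<or> k = block x p" if "?m k \<noteq> m k" for k
    using that t(6) by blast
  have outside: "\<not> I (block x p) - {m (block x p)} \<subseteq> B"
    using g xp x p d by auto
  have changed: "\<not> I k - {m k} \<subseteq> B - {a}" if "?m k \<noteq> m k" for k
    using changed_cases[OF that] outside me ax ap x p d by auto
  show False
  proof (cases "m (block a x) = a \<and> m (block a p) = a")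
    case True
    have "\<not> I k - {m k} \<subseteq> B" if "?m k \<noteq> m k" for k
      using changed_cases[OF that] outside True ax ap x p d by auto
    then show False
      using no_growth[OF t(1,2), of a "third a x"] Jx True sx d a by auto
  next
    case nb: False
    show False
    proof (cases "m (block a x) = x \<and> m (block a p) = p")
      case True
      have "(third a x, x) \<in> adj ?m" "(third a p, p) \<in> adj ?m"
        using Jx Jp True d adj_sym by auto
      then show False
        using no_growth_but_one[OF a t(1,2) changed, of "third a x" x "third a p" p]
          True sx sp ax ap x p d by auto
    next
      case False
      have "\<exists>z v. (v, z) \<in> adj ?m \<and> v \<in> B - {a} \<and> z \<notin> B"
      proof (cases "m (block a x) = x")
        case True
        then show ?thesis
          using Jx adj_sym sx ax x d by (intro exI[of _ x] exI[of _ "third a x"]) auto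
      next
        case f: False
        then have "m (block a p) = p" using nb me by auto
        then show ?thesis
          using Jp adj_sym sp ap p d by (intro exI[of _ p] exI[of _ "third a p"]) auto
      qed
      then obtain z v where v: "(v, z) \<in> adj ?m" "v \<in> B - {a}" "z \<notin> B" by blast
      have "\<exists>f. \<forall>k. k \<in> E \<and> ?m k \<noteq> m k \<and> a \<in> I k \<and> m k \<noteq> a \<longrightarrow> k = f"
      proof (cases "m (block a x) = a")
        case True
        then show ?thesis using changed_cases ga by (intro exI[of _ "block a p"]) auto
      next
        case f: False
        then have "m (block a p) = a" using False me by auto
        then show ?thesis using changed_cases ga by (intro exI[of _ "block a x"]) auto
      qed
      then obtain y where y: "y \<in> B - {a}" "(y, a) \<in> adj ?m"
        using still_attached[OF a(1)] by metis
      show False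
        using no_growth_but_one[OF a t(1,2) changed, of y a v z] y v a by auto
    qed
  qed
qed

section \<open>Index one: the outside of a largest class\<close>

abbreviation "A \<equiv> V - B"

text \<open>
  All pairs of vertices outside \<open>B\<close> are chosen.  Since a block has only one chosen pair, no block
  has all of its vertices outside \<open>B\<close>.
\<close>

lemma clique:
  assumes "a \<in> A" "b \<in> A" "a \<noteq> b"
  shows "m (block a b) = third a b" "third a b \<in> B" "(a, b) \<in> adj m"
    "block a b \<in> E" "I (block a b) = {a, b, third a b}"
proof -
  note ab = block_in[of a b] third_in[of a b]
  have mi: "m (block a b) \<in> I (block a b)" using ch ab assms by (auto simp: choice_def)
  then show 1: "m (block a b) = third a b"
    using outside_adjacent[OF assms] ab assms by auto
  show "(a, b) \<in> adj m" using outside_adjacent[OF assms] ab assms by (intro adjI[of "block a b"]) auto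
  show "block a b \<in> E" "I (block a b) = {a, b, third a b}" using ab assms by auto
  show "third a b \<in> B"
  proof (rule ccontr)
    assume "third a b \<notin> B"
    then have "m (block a (third a b)) \<notin> {a, third a b}"
      using outside_adjacent[of a "third a b"] ab assms by auto
    then show False using third_third[of a b] 1 assms by auto
  qed
qed

lemma third_inj:
  assumes "a \<in> A" "b \<in> A" "c \<in> A" "a \<noteq> b" "a \<noteq> c" "b \<noteq> c"
  shows "third a b \<noteq> third a c"
  using third_third[of a b] third_third[of a c] assms by auto

text \<open>
  Let \<open>t\<close> and \<open>t'\<close> be the third vertices of the blocks through \<open>a, b\<close> and through \<open>a, c\<close>.  If the
  block through \<open>t\<close> and \<open>t'\<close> were flippable there, the triangle \<open>a, t, t'\<close> would replace the pairs
  \<open>{a, b}\<close> and \<open>{a, c}\<close> by \<open>{b, t}\<close> and \<open>{c, t'}\<close>.  The one pair that \<open>B\<close> loses is bypassed by the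
  path from \<open>t\<close> over \<open>b\<close> and \<open>c\<close> to \<open>t'\<close>, so \<open>B\<close> would be enlarged by \<open>b\<close>.
\<close>

lemma thirds_adjacent:
  assumes abc: "a \<in> A" "b \<in> A" "c \<in> A" "a \<noteq> b" "a \<noteq> c" "b \<noteq> c"
  shows "m (block (third a b) (third a c)) \<notin> {third a b, third a c}"
proof
  define t t' where tt: "t = third a b" "t' = third a c"
  let ?g = "block t t'"
  assume "m (block (third a b) (third a c)) \<in> {third a b, third a c}"
  then have g: "m ?g \<in> {t, t'}" by (simp add: tt)
  note ab = clique[OF abc(1,2,4), folded tt] and ac = clique[OF abc(1,3,5), folded tt]
    and bc = clique[OF abc(2,3,6)]
  have "t \<noteq> t'" using third_inj[OF abc] by (simp add: tt)
  have at: "block a t = block a b" "block a t' = block a c" using third_third[of a b] third_third[of a c] abc by (auto simp: tt)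
  have V: "a \<in> V" "t \<in> V" "t' \<in> V" and d: "a \<noteq> t" "a \<noteq> t'" "t \<noteq> t'"
    using abc ab ac BV \<open>t \<noteq> t'\<close> by auto
  have free: "t' \<notin> I (block a t)" using at ab ac d abc by auto
  have miss: "m (block a t) \<in> {a, t}" "m (block a t') \<in> {a, t'}" using at ab(1) ac(1) by simp_all
  note tr = triangle[OF V d free miss g, unfolded at ab(1) ac(1)]
  let ?m = "tri a t t'"
  have mab: "?m (block a b) = a" and mac: "?m (block a c) = a" using tr(3,4) d by simp_all
  obtain w where w: "I ?g = {t, t', w}" "w \<noteq> t" "w \<noteq> t'" "?g \<in> E"
    using third_in[OF V(2,3) d(3)] block_in[OF V(2,3) d(3)] by blast
  have J1: "(b, t) \<in> adj ?m" using ab abc mab d by (intro adjI[of "block a b"]) auto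
  have J2: "(c, t') \<in> adj ?m" using ac abc mac d by (intro adjI[of "block a c"]) auto
  have "b \<in> I (block b c)" "c \<in> I (block b c)" unfolding bc(5) by simp_all
  moreover have "c \<notin> I (block a b)" unfolding ab(5) using ab(2) abc by auto
  moreover have "b \<notin> I (block a c)" unfolding ac(5) using ac(2) abc by auto
  moreover have "b \<notin> I ?g \<or> c \<notin> I ?g" unfolding w(1) using ab(2) ac(2) abc by auto
  ultimately have "block b c \<noteq> block a b" "block b c \<noteq> block a c" "block b c \<noteq> ?g"
    by metis+
  then have mbc: "?m (block b c) = third b c" using tr(6)[of "block b c"] bc(1) by simp
  have "third b c \<noteq> b" "third b c \<noteq> c" using bc(2) abc by auto
  then have J3: "(b, c) \<in> adj ?m"
    using adjI[of "block b c" b c ?m] bc(4,5) abc(6) mbc by simp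
  have path: "(t, t') \<in> (adj ?m)\<^sup>*"
    using J1 J2 J3 adj_sym by (meson converse_rtrancl_into_rtrancl rtrancl.rtrancl_refl)
  have Jg: "(m ?g, w) \<in> adj ?m" using w g tr(5) d by (intro adjI[of ?g]) auto
  have "(t, w) \<in> (adj ?m)\<^sup>*" "(t', w) \<in> (adj ?m)\<^sup>*"
    using Jg g path rtrancl_adj_sym[OF path] by (auto intro: rtrancl_into_rtrancl)
  then have all: "(y, z) \<in> (adj ?m)\<^sup>*" if "y \<in> {t, t', w}" "z \<in> {t, t', w}" for y z
    using that path rtrancl_adj_sym by auto
  have "B \<subseteq> reach ?m t"
  proof (rule reach_rerouted[OF conn_B])
    show "t \<in> B" using ab by simp
    fix y z assume yz: "y \<in> B" "z \<in> B" "(y, z) \<in> adj m"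
    obtain k where k: "k \<in> E" "y \<in> I k" "z \<in> I k" "y \<noteq> z" "m k \<noteq> y" "m k \<noteq> z"
      using adjE[OF yz(3)] by metis
    show "(y, z) \<in> (adj ?m)\<^sup>*"
    proof (cases "k = ?g")
      case True
      then show ?thesis using k w all by blast
    next
      case False
      have "k \<noteq> block a b" "k \<noteq> block a c" using k yz ab ac abc by auto
      then have "?m k = m k" using tr(6) False by blast
      then have "(y, z) \<in> adj ?m" using k by (intro adjI[of k]) auto
      then show ?thesis by blast
    qed
  qed
  moreover have "b \<in> reach ?m t" using J1 adj_sym unfolding reach_def by blast
  ultimately show False
    using no_larger[OF tr(1,2) V(2), of "insert b B"] abc finB by auto
qed

text \<open>
  Let \<open>t, t', t''\<close> be the third vertices of the blocks through \<open>a, b\<close>, through \<open>a, c\<close> and through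
  \<open>b, c\<close>; they are pairwise joined by chosen pairs.  Suppose the block through \<open>t\<close> and \<open>t'\<close> has its
  third vertex \<open>v\<close> in \<open>B\<close>.  The chosen pair of the block \<open>{a, v, w}\<close> is then \<open>{v, w}\<close>, and the
  triangle \<open>a, t, v\<close> replaces the pairs \<open>{a, b}\<close>, \<open>{v, w}\<close>, \<open>{t, t'}\<close> by \<open>{b, t}\<close>, \<open>{a, w}\<close>,
  \<open>{t', v}\<close>.  The path \<open>v, t', t'', t, b, c, a, w\<close> bypasses what \<open>B\<close> loses, and \<open>B\<close> is enlarged by
  \<open>b\<close>.
\<close>

lemma third_of_thirds_outside:
  assumes abc: "a \<in> A" "b \<in> A" "c \<in> A" "a \<noteq> b" "a \<noteq> c" "b \<noteq> c"
  shows "third (third a b) (third a c) \<in> A"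
proof (rule ccontr)
  define t t' t'' where tt: "t = third a b" "t' = third a c" "t'' = third b c"
  define v where "v = third t t'"
  let ?e = "block a b" and ?g = "block t t'" and ?h = "block a v"
  note ab = clique[OF abc(1,2,4), folded tt] and ac = clique[OF abc(1,3,5), folded tt]
    and bc = clique[OF abc(2,3,6), folded tt]
  have tV: "t \<in> V" "t' \<in> V" "t'' \<in> V" using ab ac bc BV by auto
  have third_b: "third b a = t" "third c a = t'" "third c b = t''"
    using third_commute[of a b] third_commute[of a c] third_commute[of b c] abc tt by auto
  have ne: "t \<noteq> t'" "t \<noteq> t''" "t' \<noteq> t''"
    using third_inj[OF abc] third_inj[of b a c] third_inj[of c a b] abc third_b tt by auto
  have spread: "m ?g \<notin> {t, t'}" "m (block t t'') \<notin> {t, t''}" "m (block t' t'') \<notin> {t', t''}"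
    using thirds_adjacent[OF abc] thirds_adjacent[of b a c] thirds_adjacent[of c a b] abc third_b tt
    by auto
  have g: "?g \<in> E" "I ?g = {t, t', v}" "v \<noteq> t" "v \<noteq> t'" "v \<in> V"
    using third_in[OF tV(1,2) ne(1)] block_in[OF tV(1,2) ne(1)] by (auto simp: v_def)
  then have mg: "m ?g = v" using spread ch by (auto simp: choice_def)
  assume "third (third a b) (third a c) \<notin> A"
  then have vB: "v \<in> B" using g by (auto simp: v_def tt)
  then have av: "a \<noteq> v" "a \<in> V" "b \<in> V" "c \<in> V" using abc by auto
  define w where "w = third a v"
  have h: "?h \<in> E" "I ?h = {a, v, w}" "w \<noteq> a" "w \<noteq> v" "w \<in> V"
    using block_in[of a v] third_in[of a v] av g by (auto simp: w_def)
  have tv: "block t v = ?g" using block_eq[of ?g t v] g by auto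
  have at: "block a t = ?e" "third a t = b" using third_third[of a b] abc by (auto simp: tt)
  have at': "block a t' = block a c" "third a t' = c" using third_third[of a c] abc by (auto simp: tt)
  have wt: "w \<noteq> b" "w \<noteq> c" "w \<noteq> t" "w \<noteq> t'"
  proof -
    have v_eq: "v = third a w" using third_third[of a v] av g by (simp add: w_def)
    show "w \<noteq> b" "w \<noteq> c" using v_eq g tt by auto
    show "w \<noteq> t" "w \<noteq> t'" using v_eq at at' vB abc by auto
  qed
  have v_eq: "v = third a w" using third_third[of a v] av g by (simp add: w_def)
  \<comment> \<open>If \<open>w\<close> were outside, then \<open>v\<close> would be the third vertex of a block through \<open>a\<close> and \<open>w\<close>, and
    hence joined to \<open>t\<close>; but the block through \<open>t\<close> and \<open>v\<close> misses \<open>v\<close>.\<close>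
  have wB: "w \<in> B"
  proof (rule ccontr)
    assume "w \<notin> B"
    then have "m (block (third a b) (third a w)) \<notin> {third a b, third a w}"
      using thirds_adjacent[of a b w] abc h wt by auto
    then show False using tv mg v_eq tt by auto
  qed
  have mh: "m ?h = a"
    using third_side[of ?h v a w] h vB abc wB by (auto simp: insert_commute)
  have at_ne: "a \<noteq> t" "t \<noteq> v" using ab(2) abc(1) g(3) by auto
  have free: "v \<notin> I (block a t)" unfolding at(1) ab(5) using g(3) vB abc(1,2) by auto
  have miss: "m (block a t) \<in> {a, t}" "m ?h \<in> {a, v}" "m (block t v) \<in> {t, v}"
    unfolding at(1) tv ab(1) mg mh by simp_all
  note tr = triangle[OF av(2) tV(1) g(5) at_ne(1) av(1) at_ne(2) free miss, unfolded at(1) tv ab(1) mg mh]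
  let ?m = "tri a t v"
  have me: "?m ?e = a" and mh': "?m ?h = v" and mg': "?m ?g = t"
    using tr(3-5) at_ne by simp_all
  have unchanged: "(y, z) \<in> adj ?m"
    if "k \<in> E" "y \<in> I k" "z \<in> I k" "y \<noteq> z" "m k \<noteq> y" "m k \<noteq> z" "k \<noteq> ?e" "k \<noteq> ?h" "k \<noteq> ?g" for k y z
    using that tr(6)[OF that(7-9)] by (intro adjI[of k]) auto
  have J1: "(b, t) \<in> adj ?m"
    using adjI[of ?e b t ?m] ab(2,4,5) abc me at_ne by auto
  have J2: "(a, w) \<in> adj ?m"
    using adjI[of ?h a w ?m] h av(1) mh' by auto
  have J3: "(t', v) \<in> adj ?m"
    using adjI[of ?g t' v ?m] g ne(1) mg' by auto
  have c_e: "c \<notin> I ?e" unfolding ab(5) using ab(2) abc by auto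
  have c_h: "c \<notin> I ?h" unfolding h(2) using vB wt(2) abc by auto
  have c_g: "c \<notin> I ?g" unfolding g(2) using vB ab(2) ac(2) abc by auto
  have J4: "(b, c) \<in> adj ?m"
  proof (rule unchanged[of "block b c"])
    show c: "c \<in> I (block b c)" "b \<in> I (block b c)" unfolding bc(5) by simp_all
    show "block b c \<noteq> ?e" "block b c \<noteq> ?h" "block b c \<noteq> ?g" using c(1) c_e c_h c_g by metis+
    show "m (block b c) \<noteq> b" "m (block b c) \<noteq> c" unfolding bc(1) using bc(2) abc by auto
  qed (use bc(4) abc in auto)
  have J5: "(a, c) \<in> adj ?m"
  proof (rule unchanged[of "block a c"])
    show c: "c \<in> I (block a c)" "a \<in> I (block a c)" unfolding ac(5) by simp_all
    show "block a c \<noteq> ?e" "block a c \<noteq> ?h" "block a c \<noteq> ?g" using c(1) c_e c_h c_g by metis+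
    show "m (block a c) \<noteq> a" "m (block a c) \<noteq> c" unfolding ac(1) using ac(2) abc by auto
  qed (use ac(4) abc in auto)
  note b1 = block_in[OF tV(1,3) ne(2)] and b2 = block_in[OF tV(2,3) ne(3)]
  have t''_v: "t'' \<notin> I ?g"
  proof
    assume "t'' \<in> I ?g"
    then have "t'' = v" using g(2) ne by auto
    moreover have "t'' \<in> I (block t t'')" "block t t'' = ?g"
      using b1 block_eq[of ?g t t''] \<open>t'' \<in> I ?g\<close> g(1,2) ne(2) by auto
    ultimately show False using spread(2) mg by simp
  qed
  have t_h: "t \<notin> I ?h" unfolding h(2) using at_ne wt(3) by auto
  have t'_h: "t' \<notin> I ?h" unfolding h(2) using g(4) wt(4) ac(2) abc(1) by auto
  have t'_e: "t' \<notin> I ?e" unfolding ab(5) using ac(2) abc ne(1) by auto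
  have J6: "(t, t'') \<in> adj ?m"
  proof (rule unchanged[of "block t t''"])
    show "block t t'' \<noteq> ?e"
    proof
      assume "block t t'' = ?e"
      then show False using spread(2) ab(1) by simp
    qed
    show "block t t'' \<noteq> ?h" "block t t'' \<noteq> ?g" using b1 t_h t''_v by metis+
  qed (use b1 ne(2) spread(2) in auto)
  have J7: "(t', t'') \<in> adj ?m"
  proof (rule unchanged[of "block t' t''"])
    show "block t' t'' \<noteq> ?e" "block t' t'' \<noteq> ?h" "block t' t'' \<noteq> ?g" using b2 t'_e t'_h t''_v by metis+
  qed (use b2 ne(3) spread(3) in auto)
  have sub: "{a, b, c, v, w, t', t''} \<subseteq> reach ?m t"
  proof -
    have r0: "t \<in> reach ?m t" by simp
    have r1: "b \<in> reach ?m t" "t'' \<in> reach ?m t"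
      using reach_closed[OF r0] J1 J6 adj_sym by blast+
    have r2: "c \<in> reach ?m t" "t' \<in> reach ?m t"
      using reach_closed[OF r1(1) J4] reach_closed[OF r1(2) adj_sym[OF J7]] by blast+
    have r3: "a \<in> reach ?m t" "v \<in> reach ?m t"
      using reach_closed[OF r2(1) adj_sym[OF J5]] reach_closed[OF r2(2) J3] by blast+
    have "w \<in> reach ?m t"
      using reach_closed[OF r3(1) J2] .
    then show ?thesis using r1 r2 r3 by blast
  qed
  have all: "(y, z) \<in> (adj ?m)\<^sup>*" if "y \<in> {v, w, t, t'}" "z \<in> {v, w, t, t'}" for y z
  proof -
    have "(t, y) \<in> (adj ?m)\<^sup>*" "(t, z) \<in> (adj ?m)\<^sup>*" using that sub unfolding reach_def by auto
    then show ?thesis using rtrancl_adj_sym rtrancl_trans by metis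
  qed
  have "B \<subseteq> reach ?m t"
  proof (rule reach_rerouted[OF conn_B])
    show "t \<in> B" using ab by simp
    fix y z assume yz: "y \<in> B" "z \<in> B" "(y, z) \<in> adj m"
    obtain k where k: "k \<in> E" "y \<in> I k" "z \<in> I k" "y \<noteq> z" "m k \<noteq> y" "m k \<noteq> z"
      using adjE[OF yz(3)] by metis
    show "(y, z) \<in> (adj ?m)\<^sup>*"
    proof (cases "k = ?g \<or> k = ?h")
      case True
      then have "y \<in> {v, w, t, t'}" "z \<in> {v, w, t, t'}" using k g h yz abc by auto
      then show ?thesis by (rule all)
    next
      case False
      have "k \<noteq> ?e" using k yz ab abc by auto
      then show ?thesis using unchanged k False by blast
    qed
  qed
  then show False
    using no_larger[OF tr(1,2) tV(1), of "insert b B"] sub abc finB by auto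
qed

text \<open>
  Put \<open>t = third a c\<close>.  Mapping \<open>d\<close> to the third vertex of the block through \<open>t\<close> and \<open>third a d\<close> is
  an injection from the finite set \<open>A - {a, c}\<close> into itself, so its image contains \<open>b\<close>.
\<close>

lemma third_through_pencil:
  assumes ac: "a \<in> A" "c \<in> A" "a \<noteq> c" and b: "b \<in> A - {a, c}"
  obtains d where "d \<in> A - {a, c}" "third (third a c) b = third a d"
proof -
  define X where "X = A - {a, c}"
  define t where "t = third a c"
  define \<phi> where "\<phi> d = third t (third a d)" for d
  have t: "t \<in> B" "t \<in> V" "a \<in> V" "c \<in> V" using clique[OF ac] BV ac by (auto simp: t_def)
  have "t \<noteq> a" "t \<noteq> c" using t(1) ac by auto
  then have at: "third t a = c" "third t c = a"
    using third_third[of a c] third_third[of c a] third_commute[of a c] third_commute[of t a] third_commute[of t c] t ac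
    by (auto simp: t_def)
  have td: "third a d \<in> B" "third a d \<in> V" "third a d \<noteq> t" if "d \<in> X" for d
    using clique[of a d] BV that ac third_inj[of a d c] by (auto simp: X_def t_def)
  have inv: "third t (\<phi> d) = third a d" if "d \<in> X" for d
    using third_third[of t "third a d"] td[OF that] t by (auto simp: \<phi>_def)
  have "\<phi> ` X \<subseteq> X"
  proof clarify
    fix d assume d: "d \<in> X"
    have "\<phi> d \<in> A"
      using third_of_thirds_outside[of a c d] ac d by (auto simp: X_def t_def \<phi>_def)
    moreover have "\<phi> d \<noteq> a" "\<phi> d \<noteq> c"
      using inv[OF d] at td[OF d] ac by auto
    ultimately show "\<phi> d \<in> X" by (simp add: X_def)
  qed
  moreover have "inj_on \<phi> X"
  proof (rule inj_onI)
    fix d d' assume dd: "d \<in> X" "d' \<in> X" "\<phi> d = \<phi> d'"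
    then have "third a d = third a d'" using inv by metis
    then show "d = d'" using third_inj[of a d d'] dd ac by (auto simp: X_def)
  qed
  moreover have "finite X" using finV by (simp add: X_def)
  ultimately have "\<phi> ` X = X" by (simp add: endo_inj_surj)
  then obtain d where "d \<in> X" "b = \<phi> d" using b unfolding X_def[symmetric] by blast
  then show thesis using that[of d] inv[of d] by (auto simp: X_def t_def)
qed

text \<open>
  The third vertex of the block through \<open>third a b\<close> and \<open>c\<close> has the form \<open>third a c1\<close>, and by the
  symmetry of \<open>a\<close> and \<open>b\<close> also \<open>third b c2\<close>.  So it forms a block with \<open>b\<close> and \<open>c2\<close>, whereas the preceding
  lemma, applied to \<open>a\<close> and \<open>c1\<close>, says that the third vertex of this block is in \<open>B\<close> and not
  \<open>c2\<close>.
\<close>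

lemma no_triangle_outside:
  assumes "a \<in> A" "b \<in> A" "c \<in> A" "a \<noteq> b" "a \<noteq> c" "b \<noteq> c"
  shows False
proof -
  obtain c1 where c1: "c1 \<in> A - {a, b}" "third (third a b) c = third a c1"
    using third_through_pencil[of a b c] assms by auto
  obtain c2 where c2: "c2 \<in> A - {b, a}" "third (third b a) c = third b c2"
    using third_through_pencil[of b a c] assms by auto
  have eq: "third a c1 = third b c2" using c1 c2 third_commute[of a b] assms by auto
  obtain d where d: "d \<in> A - {a, c1}" "third (third a c1) b = third a d"
    using third_through_pencil[of a c1 b] assms c1 by auto
  have "third (third b c2) b = c2"
    using third_third[of b c2] third_commute[of b "third b c2"] third_in[of b c2] assms c2 by auto
  then have "c2 = third a d" using d eq by simp
  then show False using clique[of a d] d c2 assms by auto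
qed

text \<open>
  The degree of \<open>a\<close> is even, so a vertex outside \<open>B\<close> with one neighbour has a second one, which
  completes a triangle outside \<open>B\<close>.
\<close>

lemma single_index_all_in:
  assumes d: "(a, b) \<in> adj m"
  shows "a \<in> B"
proof (rule ccontr)
  assume "a \<notin> B"
  then have ab: "a \<in> A" "b \<in> A" "a \<noteq> b"
    using B_step[OF d] adj_in_V[OF d] d by (auto simp: adj_def)
  obtain e where e: "e \<in> E" "a \<in> I e" "m e \<noteq> a" "e \<noteq> block a b"
    using two_edges_at[OF ev d] by metis
  have me: "m e \<in> I e" using ch e by (simp add: choice_def)
  obtain c where c: "I e = {a, m e, c}" "c \<noteq> a" "c \<noteq> m e"
    using third_vertex[of e a "m e"] e me by metis
  have "(a, c) \<in> adj m" using e c by (intro adjI[of e]) auto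
  then have "c \<in> A" using \<open>a \<notin> B\<close> B_step adj_in_V by blast
  moreover have "c \<noteq> b" using block_eq[of e a b] e c ab by auto
  ultimately show False using no_triangle_outside[of a b c] ab c by auto
qed

end

section \<open>Euler tours of triple systems\<close>

context triples
begin

text \<open>
  A choice with even degrees and a component of maximal size is an instance of \<open>largest_class\<close>, where
  every chosen pair has been shown to lie in this component, separately for index one and for larger
  index.
\<close>

lemma connected_even_choice:
  assumes big: "l \<ge> 2 \<or> card V \<ge> 4"
  obtains m C where "choice m" "Odd m = {}" "conn m C" "\<And>e. e \<in> E \<Longrightarrow> I e - {m e} \<subseteq> C"
proof -
  define Q where "Q = (\<lambda>(m, x). choice m \<and> Odd m = {} \<and> x \<in> V)"
  obtain m0 where m0: "choice m0" "Odd m0 = {}"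
    using even_choice_exists big by blast
  obtain x where x: "x \<in> V" using order_ge_3 by fastforce
  have "Q (m0, x)" using m0 x by (simp add: Q_def)
  moreover have "\<forall>p. Q p \<longrightarrow> card (reach (fst p) (snd p)) < Suc (card V)"
    using reach_subset_V finV card_mono by (fastforce simp: Q_def less_Suc_eq_le)
  ultimately obtain p where p: "Q p" "\<And>q. Q q \<Longrightarrow> card (reach (fst q) (snd q)) \<le> card (reach (fst p) (snd p))"
    using ex_has_greatest_nat[of Q _ "\<lambda>p. card (reach (fst p) (snd p))"] by blast
  obtain m x0 where mx: "p = (m, x0)" by fastforce
  have m: "choice m" "Odd m = {}" "x0 \<in> V" using p(1) by (auto simp: Q_def mx)
  have largest: "card (reach m' x) \<le> card (reach m x0)" if "choice m'" "Odd m' = {}" "x \<in> V" for m' x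
    using p(2)[of "(m', x)"] that by (simp add: Q_def mx)
  have pair: "\<exists>a b. I e - {m e} = {a, b} \<and> (a, b) \<in> adj m" if e: "e \<in> E" for e
  proof -
    have me: "m e \<in> I e" using m e by (simp add: choice_def)
    obtain b c where bc: "I e = {m e, b, c}" "m e \<noteq> b" "b \<noteq> c" "m e \<noteq> c"
      using two_vertices[OF e me] by blast
    then have "b \<in> I e" "c \<in> I e" by auto
    then have "(b, c) \<in> adj m" using e bc by (intro adjI[of e]) auto
    moreover have "I e - {m e} = {b, c}" using bc by auto
    ultimately show ?thesis by blast
  qed
  obtain e where e: "e \<in> E" using E_ne by blast
  then obtain a b where ab: "(a, b) \<in> adj m" using pair by blast
  then have "{a, b} \<subseteq> reach m a" "a \<noteq> b" "a \<in> V"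
    using reach_closed[of a m a b] adj_in_V by (auto simp: adj_def)
  moreover have "finite (reach m a)"
    using reach_subset_V[OF \<open>a \<in> V\<close>] finV finite_subset by blast
  ultimately have "2 \<le> card (reach m a)"
    using card_mono[of "reach m a" "{a, b}"] by simp
  also have "\<dots> \<le> card (reach m x0)" using largest m \<open>a \<in> V\<close> by blast
  finally have "2 \<le> card (reach m x0)" .
  then interpret largest_class V E I l m "reach m x0" x0
    using m largest by unfold_locales auto
  have all_in: "y \<in> reach m x0" if "(y, z) \<in> adj m" for y z
  proof (cases "l \<ge> 2")
    case True
    then show ?thesis using double_index_all_in that by blast
  next
    case False
    then have "l = 1" using index_pos by simp
    then interpret steiner_class V E I l m "reach m x0" x0
      by unfold_locales
    show ?thesis using single_index_all_in that by blast
  qed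
  have "I e - {m e} \<subseteq> reach m x0" if "e \<in> E" for e
  proof -
    obtain a b where ab: "I e - {m e} = {a, b}" "(a, b) \<in> adj m" using pair \<open>e \<in> E\<close> by blast
    then show ?thesis using all_in[OF ab(2)] all_in[OF adj_sym[OF ab(2)]] by simp
  qed
  then show thesis using that[of m "reach m x0"] m conn_reach by blast
qed

lemma closed_trail_exists:
  assumes big: "l \<ge> 2 \<or> card V \<ge> 4"
  obtains p u es where "\<And>e. e \<in> E \<Longrightarrow> p e \<subseteq> I e" "trail p u es u" "distinct es" "set es = E"
proof -
  obtain m C where m: "choice m" "Odd m = {}" "conn m C" "\<And>e. e \<in> E \<Longrightarrow> I e - {m e} \<subseteq> C"
    using connected_even_choice big by metis
  define p where "p e = I e - {m e}" for e
  have two: "card (p e) = 2" if "e \<in> E" for e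
    using m(1) that I3[OF that] by (simp add: p_def choice_def)
  have "even (card {e \<in> E. x \<in> p e})" for x
  proof (cases "x \<in> V")
    case True
    have "{e \<in> E. x \<in> p e} = {e \<in> E. x \<in> I e \<and> m e \<noteq> x}" by (auto simp: p_def)
    then show ?thesis using m(2) True by (auto simp: Odd_def deg_def)
  next
    case False
    then have "{e \<in> E. x \<in> p e} = {}" using IV by (auto simp: p_def)
    then show ?thesis by (metis card.empty even_zero)
  qed
  moreover have "\<exists>e\<in>F. \<exists>e'\<in>E - F. p e \<inter> p e' \<noteq> {}" if F: "F \<subseteq> E" "F \<noteq> {}" "F \<noteq> E" for F
  proof (rule ccontr)
    assume no: "\<not> ?thesis"
    define D where "D = (\<Union>e\<in>F. p e)"
    obtain f f' where f: "f \<in> F" "f' \<in> E - F" using F by blast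
    have ne: "p f \<noteq> {}" "p f' \<noteq> {}" using two f F by (force)+
    have "D \<subseteq> C" using m(4) F by (auto simp: D_def p_def)
    moreover have "D \<noteq> {}" using f ne by (auto simp: D_def)
    moreover have "D \<noteq> C"
      using f ne m(4)[of f'] no by (auto simp: D_def p_def)
    ultimately obtain y z where yz: "y \<in> D" "z \<in> C - D" "(y, z) \<in> adj m"
      using conn_exit[OF m(3)] by blast
    obtain e where e: "e \<in> E" "y \<in> I e" "z \<in> I e" "y \<noteq> z" "m e \<noteq> y" "m e \<noteq> z"
      using adjE[OF yz(3)] by metis
    have "z \<in> p e" "y \<in> p e" using e by (auto simp: p_def)
    then show False using yz e no by (auto simp: D_def)
  qed
  ultimately obtain u es where "trail p u es u" "distinct es" "set es = E"
    using euler_circuit[of E p] finE two E_ne by blast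
  then show thesis using that[of p u es] by (auto simp: p_def)
qed

end

lemma triple_system_3_1_not_eulerian:
  assumes "triple_system 3 1 H"
  shows "\<not> eulerian H"
proof
  assume "eulerian H"
  then obtain vs es where t: "walk H vs es" "hd vs = last vs" "distinct es" "set es = edges H"
    by (auto simp: eulerian_def euler_tour_def closed_walk_def strict_trail_def)
  have H: "hypergraph H" "uniform 3 H" "card (verts H) = 3" "edges H \<noteq> {}"
    "\<And>u v. u \<in> verts H \<Longrightarrow> v \<in> verts H \<Longrightarrow> u \<noteq> v \<Longrightarrow>
      card {e \<in> edges H. u \<in> ends H e \<and> v \<in> ends H e} = 1"
    using assms by (auto simp: triple_system_def order_def)
  have all: "ends H e = verts H" if "e \<in> edges H" for e
    using H that by (metis card_subset_eq hypergraph.ends_subset hypergraph.finite_verts uniform_def)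
  obtain u v where uv: "u \<in> verts H" "v \<in> verts H" "u \<noteq> v"
    using H(3) by (auto simp: card_3_iff)
  have "{e \<in> edges H. u \<in> ends H e \<and> v \<in> ends H e} = edges H"
    using all uv by auto
  then have "card (edges H) = 1"
    using H(5)[OF uv] by simp
  then have "length es = 1"
    using t distinct_card by metis
  moreover from this have "length vs = 2" "vs ! 0 \<noteq> vs ! 1"
    using t(1) by (auto simp: walk_def)
  ultimately show False
    using t(2) by (cases vs; cases "tl vs") (auto simp: hd_conv_nth last_conv_nth)
qed

theorem theorem4p2p9:
  fixes H :: "('v, 'e) pre_hypergraph" and n l :: nat
  assumes "triple_system n l H"
  shows "eulerian H \<longleftrightarrow> \<not> triple_system 3 1 H"
proof
  assume "eulerian H"
  then show "\<not> triple_system 3 1 H"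
    using triple_system_3_1_not_eulerian by blast
next
  assume no31: "\<not> triple_system 3 1 H"
  interpret triples "verts H" "edges H" "ends H" l
    using assms
    by unfold_locales
      (auto simp: triple_system_def hypergraph_def uniform_def)
  have "l \<ge> 2 \<or> card (verts H) \<ge> 4"
  proof (rule ccontr)
    assume "\<not> ?thesis"
    then have "l = 1" "card (verts H) = 3"
      using index_pos order_ge_3 by auto
    then show False
      using no31 assms by (auto simp: triple_system_def order_def)
  qed
  then obtain p u es where *: "\<And>e. e \<in> edges H \<Longrightarrow> p e \<subseteq> ends H e" "trail p u es u" "distinct es"
    "set es = edges H"
    using closed_trail_exists by metis
  obtain e es' where es: "es = e # es'"
    using *(4) E_ne by (cases es) auto
  then have "u \<in> p e"
    using *(2) by (auto simp: trail_Cons_iff)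
  moreover have "e \<in> edges H"
    using es *(4) by auto
  ultimately have "u \<in> verts H"
    using *(1) IV by blast
  then have "\<exists>vs. walk H vs es \<and> hd vs = u \<and> last vs = u"
    by (intro trail_imp_walk[OF *(2)]) (use *(1,4) IV in auto)
  then show "eulerian H"
    using *(3,4) unfolding eulerian_def euler_tour_def closed_walk_def strict_trail_def by metis
qed

end
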